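(* Let $M$ be a von Neumann algebra, let $(\alpha_t)_{t\in\mathbb R}$ be a weak$^*$-continuous one-parameter automorphism group of $M$, let $x\in M$, let $z\in\mathbb C$, and let $f:S(z)\to M$ be a weak$^*$-regular extension of $t\mapsto\alpha_t(x)$, that is, a weak$^*$-regular map with $f(t)=\alpha_t(x)$ for all $t\in\mathbb R$. Then $f$ is continuous (on all of $S(z)$) for the $\sigma$-strong$^*$ topology on $M$ (and so also for the $\sigma$-strong topology).
   Context: A weak$^*$-continuous one-parameter automorphism group of $M$ is a family $(\alpha_t)_{t\in\mathbb R}$ of weak$^*$-continuous $*$-automorphisms of $M$ with $\alpha_0=\mathrm{id}$, $\alpha_t\circ\alpha_s=\alpha_{t+s}$, and with $t\mapsto\alpha_t(x)$ weak$^*$-continuous for each $x\in M$. For $z\in\mathbb C\setminus\mathbb R$, $S(z)=\{w\in\mathbb C: 0\le \operatorname{Im} w/\operatorname{Im} z\le 1\}$; for $z\in\mathbb R$, $S(z)=\mathbb R$. A map $f:S(z)\to M$ is weak$^*$-regular if it is weak$^*$-continuous on $S(z)$ and analytic in the interior of $S(z)$. The $\sigma$-strong topology is given by the seminorms $x\mapsto\langle x^*x,\omega\rangle^{1/2}$, and the $\sigma$-strong$^*$ topology by the seminorms $x\mapsto\langle x^*x+xx^*,\omega\rangle^{1/2}$, for $\omega\in M_*^+$. *)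

theory Defs
  imports "HOL-Analysis.Analysis"
begin

section \<open>Complex Hilbert spaces and their bounded operators\<close>

text \<open>The inner product is linear in its first argument. The real Banach space structure
  comes from \<^class>\<open>banach\<close>. The axiom \<open>cinner_self\<close> contains positivity, definiteness and the
  fact that the norm is the one of the inner product.\<close>

class complex_hilbert = banach +
  fixes scaleC :: "complex \<Rightarrow> 'a \<Rightarrow> 'a"
    and cinner :: "'a \<Rightarrow> 'a \<Rightarrow> complex"
  assumes scaleC_add_right: "scaleC c (v + w) = scaleC c v + scaleC c w"
    and scaleC_add_left: "scaleC (c + d) v = scaleC c v + scaleC d v"
    and scaleC_scaleC: "scaleC c (scaleC d v) = scaleC (c * d) v"
    and scaleC_of_real: "scaleC (complex_of_real r) v = r *\<^sub>R v"
    and cinner_commute: "cinner v w = cnj (cinner w v)"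
    and cinner_add_left: "cinner (u + v) w = cinner u w + cinner v w"
    and cinner_scaleC_left: "cinner (scaleC c v) w = c * cinner v w"
    and cinner_self: "cinner v v = complex_of_real ((norm v)\<^sup>2)"

text \<open>Elements of \<open>'h \<Rightarrow>\<^sub>L 'h\<close> are only real-linear, so \<open>B(H)\<close> is the following subset.\<close>

type_synonym 'h op = "'h \<Rightarrow>\<^sub>L 'h"

definition bounded_ops :: "'h::complex_hilbert op set" where
  "bounded_ops = {T :: 'h op. \<forall>c v. T (scaleC c v) = scaleC c (T v)}"

definition scaleC_op :: "complex \<Rightarrow> 'h::complex_hilbert op \<Rightarrow> 'h op" where
  "scaleC_op c T = Blinfun (\<lambda>v. scaleC c (T v))"

definition is_adjoint :: "'h::complex_hilbert op \<Rightarrow> 'h op \<Rightarrow> bool" where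
  "is_adjoint T S \<longleftrightarrow> (\<forall>v w. cinner (T v) w = cinner v (S w))"

definition adj :: "'h::complex_hilbert op \<Rightarrow> 'h op" where
  "adj T = (THE S. is_adjoint T S)"

lemma norm_scaleC: "norm (scaleC c v) = cmod c * norm v" for v :: "'h::complex_hilbert"
proof -
  have "cinner (scaleC c v) (scaleC c v) = c * cnj (cinner (scaleC c v) v)"
    by (metis cinner_scaleC_left cinner_commute)
  also have "\<dots> = complex_of_real ((cmod c * norm v)\<^sup>2)"
    by (simp add: cinner_scaleC_left cinner_self power_mult_distrib complex_norm_square
        flip: of_real_power)
  finally have "(norm (scaleC c v))\<^sup>2 = (cmod c * norm v)\<^sup>2"
    unfolding cinner_self of_real_eq_iff .
  then show ?thesis by simp
qed

lemma bounded_linear_scaleC: "bounded_linear (scaleC c :: 'h::complex_hilbert \<Rightarrow> 'h)"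
proof (rule bounded_linear_intro[where K = "cmod c"])
  fix r :: real and v w :: 'h
  show "scaleC c (v + w) = scaleC c v + scaleC c w" by (rule scaleC_add_right)
  show "scaleC c (r *\<^sub>R v) = r *\<^sub>R scaleC c v"
    by (metis scaleC_of_real scaleC_scaleC mult.commute)
  show "norm (scaleC c v) \<le> norm v * cmod c" by (simp add: norm_scaleC)
qed

lemma scaleC_op_apply: "blinfun_apply (scaleC_op c T) v = scaleC c (T v)"
  unfolding scaleC_op_def
  by (subst bounded_linear_Blinfun_apply)
     (auto intro: bounded_linear_compose[OF bounded_linear_scaleC] blinfun.bounded_linear_right)

lemma cinner_add_right: "cinner w (u + v) = cinner w u + cinner w v" for w :: "'h::complex_hilbert"
  by (metis cinner_add_left cinner_commute complex_cnj_add)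

lemma adj_eqI:
  assumes "is_adjoint T S"
  shows "adj T = S"
proof -
  have "S' = S" if "is_adjoint T S'" for S'
  proof (rule blinfun_eqI)
    fix w
    have eq: "cinner v (S w) = cinner v (S' w)" for v
      using assms that by (metis is_adjoint_def)
    have "cinner v (S w - S' w) = 0" for v
      using cinner_add_right[of v "S w - S' w" "S' w"] eq[of v] by simp
    from this[of "S w - S' w"] show "S' w = S w" by (simp add: cinner_self)
  qed
  then show ?thesis unfolding adj_def using assms by blast
qed


section \<open>Von Neumann algebras and their topologies\<close>

text \<open>The locally convex topology on \<open>V\<close> given by a nonempty family \<open>P\<close> of seminorms.\<close>

definition seminorm_topology :: "'b::ab_group_add set \<Rightarrow> ('b \<Rightarrow> real) set \<Rightarrow> 'b topology" where
  "seminorm_topology V P =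
     topology_generated_by {{y \<in> V. p (y - x) < e} | p x e. p \<in> P \<and> x \<in> V \<and> e > 0}"

definition weak_operator_topology :: "'h::complex_hilbert op topology" where
  "weak_operator_topology =
     seminorm_topology bounded_ops {\<lambda>T :: 'h op. cmod (cinner (T v) w) | v w. True}"

definition von_neumann_algebra :: "'h::complex_hilbert op set \<Rightarrow> bool" where
  "von_neumann_algebra M \<longleftrightarrow>
     M \<subseteq> bounded_ops \<and>
     id_blinfun \<in> M \<and>
     (\<forall>x\<in>M. \<forall>y\<in>M. x + y \<in> M) \<and>
     (\<forall>c. \<forall>x\<in>M. scaleC_op c x \<in> M) \<and>
     (\<forall>x\<in>M. \<forall>y\<in>M. x o\<^sub>L y \<in> M) \<and>
     (\<forall>x\<in>M. \<exists>y\<in>M. is_adjoint x y) \<and>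
     closedin weak_operator_topology M"

text \<open>The functionals in the predual, of the form \<open>x \<mapsto> \<Sum>n. \<langle>x \<xi>\<^sub>n, \<eta>\<^sub>n\<rangle>\<close> with square-summable
  \<open>\<xi>\<close> and \<open>\<eta>\<close>. A functional is represented by any function that has the right values on \<open>M\<close>.\<close>

definition predual :: "'h::complex_hilbert op set \<Rightarrow> ('h op \<Rightarrow> complex) set" where
  "predual M = {\<omega> :: 'h op \<Rightarrow> complex. \<exists>\<xi> \<eta> :: nat \<Rightarrow> 'h.
     summable (\<lambda>n. (norm (\<xi> n))\<^sup>2) \<and> summable (\<lambda>n. (norm (\<eta> n))\<^sup>2) \<and>
     (\<forall>x\<in>M. (\<lambda>n. cinner (blinfun_apply x (\<xi> n)) (\<eta> n)) sums \<omega> x)}"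

definition predual_pos :: "'h::complex_hilbert op set \<Rightarrow> ('h op \<Rightarrow> complex) set" where
  "predual_pos M = {\<omega> \<in> predual M. \<forall>x\<in>M. \<omega> (adj x o\<^sub>L x) \<in> \<real>\<^sub>\<ge>\<^sub>0}"

definition weak_star_topology :: "'h::complex_hilbert op set \<Rightarrow> 'h op topology" where
  "weak_star_topology M = seminorm_topology M {\<lambda>x. cmod (\<omega> x) | \<omega>. \<omega> \<in> predual M}"

definition sigma_strong_topology :: "'h::complex_hilbert op set \<Rightarrow> 'h op topology" where
  "sigma_strong_topology M =
     seminorm_topology M {\<lambda>x. sqrt (Re (\<omega> (adj x o\<^sub>L x))) | \<omega>. \<omega> \<in> predual_pos M}"

definition sigma_strong_star_topology :: "'h::complex_hilbert op set \<Rightarrow> 'h op topology" where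
  "sigma_strong_star_topology M =
     seminorm_topology M
       {\<lambda>x. sqrt (Re (\<omega> ((adj x o\<^sub>L x) + (x o\<^sub>L adj x)))) | \<omega>. \<omega> \<in> predual_pos M}"

text \<open>These three topologies really live on \<open>M\<close>: their underlying set is \<open>M\<close>.\<close>

lemma topspace_seminorm_topology:
  assumes "p \<in> P" and "p 0 = 0"
  shows "topspace (seminorm_topology V P) = V"
proof -
  have "x \<in> {y \<in> V. p (y - x) < 1}" if "x \<in> V" for x
    using that assms(2) by simp
  then show ?thesis
    unfolding seminorm_topology_def topology_generated_by_topspace
    using assms(1) zero_less_one by blast
qed

lemma zero_in_predual_pos: "(\<lambda>_. 0) \<in> predual_pos M"
proof -
  have "(\<lambda>n. cinner (blinfun_apply x (0 :: 'a)) 0) sums 0" for x :: "'a op"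
    by (simp add: cinner_self)
  then have "(\<lambda>_. 0) \<in> predual M"
    unfolding predual_def by (auto intro!: exI[where x = "\<lambda>_. 0"])
  then show ?thesis by (simp add: predual_pos_def)
qed

lemma topspace_weak_star: "topspace (weak_star_topology M) = M"
  unfolding weak_star_topology_def using zero_in_predual_pos[of M]
  by (intro topspace_seminorm_topology[of "\<lambda>x. cmod ((\<lambda>_. 0) x)"])
     (auto simp: predual_pos_def intro!: exI[where x = "\<lambda>_. 0"])

lemma topspace_sigma_strong: "topspace (sigma_strong_topology M) = M"
  unfolding sigma_strong_topology_def using zero_in_predual_pos[of M]
  by (intro topspace_seminorm_topology[of "\<lambda>x. sqrt (Re ((\<lambda>_. 0) (adj x o\<^sub>L x)))"]) (auto intro!: exI[where x = "\<lambda>_. 0"])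

lemma topspace_sigma_strong_star: "topspace (sigma_strong_star_topology M) = M"
  unfolding sigma_strong_star_topology_def using zero_in_predual_pos[of M]
  by (intro topspace_seminorm_topology
        [of "\<lambda>x. sqrt (Re ((\<lambda>_. 0) ((adj x o\<^sub>L x) + (x o\<^sub>L adj x))))"]) (auto intro!: exI[where x = "\<lambda>_. 0"])


section \<open>One-parameter automorphism groups and regular maps\<close>

definition star_automorphism :: "'h::complex_hilbert op set \<Rightarrow> ('h op \<Rightarrow> 'h op) \<Rightarrow> bool" where
  "star_automorphism M \<phi> \<longleftrightarrow>
     bij_betw \<phi> M M \<and>
     (\<forall>x\<in>M. \<forall>y\<in>M. \<phi> (x + y) = \<phi> x + \<phi> y) \<and>
     (\<forall>c. \<forall>x\<in>M. \<phi> (scaleC_op c x) = scaleC_op c (\<phi> x)) \<and>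
     (\<forall>x\<in>M. \<forall>y\<in>M. \<phi> (x o\<^sub>L y) = \<phi> x o\<^sub>L \<phi> y) \<and>
     (\<forall>x\<in>M. \<phi> (adj x) = adj (\<phi> x))"

definition weak_star_automorphism_group ::
    "'h::complex_hilbert op set \<Rightarrow> (real \<Rightarrow> 'h op \<Rightarrow> 'h op) \<Rightarrow> bool" where
  "weak_star_automorphism_group M \<alpha> \<longleftrightarrow>
     (\<forall>t. star_automorphism M (\<alpha> t) \<and>
          continuous_map (weak_star_topology M) (weak_star_topology M) (\<alpha> t)) \<and>
     (\<forall>x\<in>M. \<alpha> 0 x = x) \<and>
     (\<forall>t s. \<forall>x\<in>M. \<alpha> t (\<alpha> s x) = \<alpha> (t + s) x) \<and>
     (\<forall>x\<in>M. continuous_map euclideanreal (weak_star_topology M) (\<lambda>t. \<alpha> t x))"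

definition strip :: "complex \<Rightarrow> complex set" where
  "strip z = (if z \<in> \<real> then \<real> else {w. 0 \<le> Im w / Im z \<and> Im w / Im z \<le> 1})"

text \<open>Analyticity of the \<open>M\<close>-valued map is tested against the predual. Norm analyticity implies
  this because functionals in the predual are norm-bounded; conversely a weak-star analytic map is
  norm analytic, so the two readings of ``analytic'' agree. That \<open>f\<close> maps the strip
  into \<open>M\<close> is part of \<^const>\<open>continuous_map\<close>.\<close>

definition weak_star_regular ::
    "'h::complex_hilbert op set \<Rightarrow> complex \<Rightarrow> (complex \<Rightarrow> 'h op) \<Rightarrow> bool" where
  "weak_star_regular M z f \<longleftrightarrow>
     continuous_map (top_of_set (strip z)) (weak_star_topology M) f \<and>
     (\<forall>\<omega>\<in>predual M. (\<lambda>w. \<omega> (f w)) holomorphic_on interior (strip z))"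

end

theory Submission
  imports Defs "HOL-Complex_Analysis.Complex_Analysis"
begin

text \<open>By uniqueness of analytic continuation, \<open>f (s + w) = \<alpha> s (f w)\<close> for real \<open>s\<close>. On the orbit of any
  \<open>y\<close> the vectors \<open>\<alpha> t y v\<close> depend norm continuously on \<open>t\<close>, because \<open>\<parallel>\<alpha> t y v - u\<parallel>\<^sup>2\<close> expands into
  weak-star continuous terms, its leading one being \<open>\<langle>\<alpha> t (y\<^sup>* y) v, v\<rangle>\<close>. Hence \<open>f\<close> is strongly
  continuous along every horizontal line. Since \<open>f\<close> is norm bounded on compact sets by uniform
  boundedness, a two-constants estimate on half squares resting on such a line, on either side of it,
  extends this to strong continuity on the whole strip. The same holds for
  \<open>w \<mapsto> (f (cnj w))\<^sup>*\<close>, which extends the orbit of \<open>x\<^sup>*\<close>. Finally \<open>\<omega> (a\<^sup>* a) = \<Sum>n. \<langle>a \<xi>\<^sub>n, a \<eta>\<^sub>n\<rangle>\<close>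
  is a locally uniform limit of functions that are continuous in a strongly continuous \<open>a\<close>.\<close>

section \<open>Uniform boundedness on a complex Hilbert space\<close>

lemma cinner_scaleC_right: "cinner v (scaleC c w) = cnj c * cinner v w"
  for v :: "'h::complex_hilbert"
  by (metis cinner_commute cinner_scaleC_left complex_cnj_mult)

lemma cinner_zero [simp]: "cinner 0 w = 0" "cinner w 0 = 0" for w :: "'h::complex_hilbert"
  using cinner_add_left[of 0 0 w] cinner_commute[of w 0] by simp_all

lemma norm_cinner_le: "cmod (cinner v w) \<le> norm v * norm w" for v w :: "'h::complex_hilbert"
proof (cases "w = 0")
  case False
  define n where "n = norm w"
  have n: "n > 0" using False by (simp add: n_def)
  define c where "c = - cinner v w / complex_of_real (n\<^sup>2)"
  have "complex_of_real ((norm (v + scaleC c w))\<^sup>2) =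
      cinner v v + c * cinner w v + cnj c * cinner v w + c * cnj c * cinner w w"
    unfolding cinner_self[symmetric]
    by (simp add: cinner_add_left cinner_add_right cinner_scaleC_left cinner_scaleC_right
        algebra_simps)
  also have "\<dots> = complex_of_real ((norm v)\<^sup>2 - (cmod (cinner v w))\<^sup>2 / n\<^sup>2)"
  proof -
    have "cinner w v = cnj (cinner v w)" by (rule cinner_commute)
    moreover have "complex_of_real ((cmod (cinner v w))\<^sup>2) = cinner v w * cnj (cinner v w)"
      using complex_norm_square[of "cinner v w"] by simp
    ultimately show ?thesis
      using n by (simp add: c_def cinner_self n_def[symmetric] field_simps power2_eq_square)
  qed
  finally have "(norm v)\<^sup>2 - (cmod (cinner v w))\<^sup>2 / n\<^sup>2 \<ge> 0"
    unfolding of_real_eq_iff by (metis zero_le_power2)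
  then have "(cmod (cinner v w))\<^sup>2 \<le> (norm v * n)\<^sup>2"
    using n by (simp add: field_simps power_mult_distrib)
  then show ?thesis
    unfolding n_def by (simp add: power2_le_iff_abs_le)
qed simp

lemma bounded_bilinear_cinner: "bounded_bilinear (cinner :: 'h::complex_hilbert \<Rightarrow> 'h \<Rightarrow> complex)"
proof
  fix r :: real and v w :: 'h
  show "cinner (r *\<^sub>R v) w = r *\<^sub>R cinner v w"
    by (metis cinner_scaleC_left scaleC_of_real scaleR_conv_of_real)
  show "cinner v (r *\<^sub>R w) = r *\<^sub>R cinner v w"
    by (metis cinner_scaleC_right scaleC_of_real scaleR_conv_of_real complex_cnj_complex_of_real)
  show "\<exists>K. \<forall>a b. norm (cinner a b) \<le> norm (a :: 'h) * norm (b :: 'h) * K"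
    by (intro exI[of _ 1]) (simp add: norm_cinner_le)
qed (rule cinner_add_left cinner_add_right)+

interpretation cinner: bounded_bilinear "cinner :: 'h::complex_hilbert \<Rightarrow> 'h \<Rightarrow> complex"
  by (rule bounded_bilinear_cinner)

lemma uniform_boundedness:
  fixes T :: "'i \<Rightarrow> 'a::banach \<Rightarrow>\<^sub>L 'b::real_normed_vector"
  assumes "\<And>v. \<exists>K. \<forall>i\<in>I. norm (T i v) \<le> K"
  obtains K where "\<And>i. i \<in> I \<Longrightarrow> norm (T i) \<le> K"
proof -
  define A where "A n = {v. \<forall>i\<in>I. norm (T i v) \<le> real n}" for n
  have closed: "closed (A n)" for n
  proof -
    have "A n = (\<Inter>i\<in>I. {v. norm (T i v) \<le> real n})" by (auto simp: A_def)
    then show ?thesis by (auto intro!: closed_INT closed_Collect_le continuous_intros)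
  qed
  have "\<exists>n. interior (A n) \<noteq> {}"
  proof (rule ccontr)
    assume "\<not> ?thesis"
    then have "euclidean interior_of \<Union>(range A) = {}"
      using closed by (intro Baire_category_alt) (auto simp: completely_metrizable_space_euclidean)
    moreover have "\<Union>(range A) = UNIV"
    proof (intro equalityI subsetI UNIV_I)
      fix v
      obtain K where K: "\<And>i. i \<in> I \<Longrightarrow> norm (T i v) \<le> K" using assms by blast
      have "v \<in> A (nat \<lceil>K\<rceil>)"
        using K by (force simp: A_def intro: order_trans real_nat_ceiling_ge)
      then show "v \<in> \<Union>(range A)" by blast
    qed
    ultimately show False by simp
  qed
  then obtain n v e where e: "e > 0" "cball v e \<subseteq> A n"
    by (meson equals0I mem_interior_cball)
  have "norm (T i) \<le> 2 * real n / e" if i: "i \<in> I" for i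
  proof (rule norm_blinfun_bound)
    fix u
    show "norm (T i u) \<le> 2 * real n / e * norm u"
    proof (cases "u = 0")
      case False
      define a where "a = e / norm u"
      have "v + a *\<^sub>R u \<in> cball v e" "v \<in> cball v e"
        using e False by (auto simp: dist_norm a_def)
      then have "norm (T i (v + a *\<^sub>R u)) \<le> n" "norm (T i v) \<le> n"
        using e i unfolding A_def by blast+
      then have "norm (T i (v + a *\<^sub>R u) - T i v) \<le> 2 * n"
        using norm_triangle_ineq4[of "T i (v + a *\<^sub>R u)" "T i v"] by simp
      then have "\<bar>a\<bar> * norm (T i u) \<le> 2 * n"
        by (simp add: blinfun.add_right blinfun.scaleR_right)
      then show ?thesis using e False by (simp add: a_def field_simps)
    qed simp
  qed (use e in simp)
  then show ?thesis by (rule that)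
qed

lemma norm_bounded_if_weakly_bounded:
  fixes T :: "'i \<Rightarrow> 'h::complex_hilbert op"
  assumes "\<And>v w. \<exists>K. \<forall>i\<in>I. cmod (cinner (T i v) w) \<le> K"
  obtains K where "K > 0" "\<And>i. i \<in> I \<Longrightarrow> norm (T i) \<le> K"
proof -
  have "\<exists>K. \<forall>i\<in>I. norm (T i v) \<le> K" for v
  proof -
    define \<phi> where "\<phi> i = Blinfun (cinner (T i v))" for i
    have \<phi>: "blinfun_apply (\<phi> i) = cinner (T i v)" for i
      unfolding \<phi>_def by (rule bounded_linear_Blinfun_apply[OF cinner.bounded_linear_right])
    obtain K where K: "\<And>i. i \<in> I \<Longrightarrow> norm (\<phi> i) \<le> K"
      using uniform_boundedness[of I \<phi>] assms[of v] by (auto simp: \<phi>)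
    have "norm (T i v) \<le> K" if "i \<in> I" for i
    proof -
      have "(norm (T i v))\<^sup>2 = norm (\<phi> i (T i v))"
        by (simp add: \<phi> cinner_self norm_power)
      also have "\<dots> \<le> K * norm (T i v)"
        using norm_blinfun[of "\<phi> i"] K[OF that] by (meson mult_right_mono norm_ge_zero order_trans)
      finally have "norm (T i v) * norm (T i v) \<le> K * norm (T i v)" by (simp add: power2_eq_square)
      moreover have "K \<ge> 0" using K[OF that] norm_ge_zero[of "\<phi> i"] by linarith
      ultimately show ?thesis by (cases "norm (T i v) = 0") auto
    qed
    then show ?thesis by blast
  qed
  then obtain K where "\<And>i. i \<in> I \<Longrightarrow> norm (T i) \<le> K" using uniform_boundedness by blast
  then show ?thesis by (intro that[of "max 1 K"]) (auto simp: le_max_iff_disj)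
qed

section \<open>A two-constants estimate\<close>

definition half_square :: "real \<Rightarrow> complex set" where
  "half_square r = {\<zeta>. \<bar>Re \<zeta>\<bar> \<le> r \<and> 0 \<le> Im \<zeta> \<and> Im \<zeta> \<le> r}"

lemma half_square_eq_cbox: "half_square r = cbox (Complex (- r) 0) (Complex r r)"
  by (auto simp: half_square_def in_cbox_complex_iff)

lemma compact_half_square: "compact (half_square r)"
  unfolding half_square_eq_cbox by (rule compact_cbox)

lemma half_square_mono: "s \<le> r \<Longrightarrow> half_square s \<subseteq> half_square r"
  by (auto simp: half_square_def)

lemma exp_decay: "((\<lambda>N. K * exp (- N * c)) \<longlongrightarrow> 0) at_top" if "c > 0" for K c :: real
proof -
  have "filterlim (\<lambda>N. - (N * c)) at_bot at_top"
    using that by (intro filterlim_uminus_at_top[THEN iffD1] filterlim_at_top_mult_tendsto_pos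
        filterlim_ident tendsto_const) auto
  then have "((\<lambda>N. exp (- (N * c))) \<longlongrightarrow> 0) at_top"
    by (rule filterlim_compose[OF exp_at_bot])
  then show ?thesis using tendsto_mult_left[of _ 0 at_top K] by simp
qed

text \<open>On the three upper sides of the half square, the real part of \<open>2 * r * \<i> * \<zeta> - \<zeta>\<^sup>2\<close> is at most
  \<open>- r\<^sup>2\<close>, and on the bottom it is at most \<open>0\<close>. Multiplication with the exponential of a large
  multiple of it makes the bound on the bottom dominate.\<close>

lemma half_square_bound:
  assumes r: "r > 0" and N: "N \<ge> 0"
    and cont: "continuous_on (half_square r) h"
    and hol: "h holomorphic_on interior (half_square r)"
    and bottom: "\<And>t. \<bar>t\<bar> \<le> r \<Longrightarrow> cmod (h (complex_of_real t)) \<le> \<epsilon>"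
    and K: "\<And>\<zeta>. \<zeta> \<in> half_square r \<Longrightarrow> cmod (h \<zeta>) \<le> K"
    and \<zeta>: "\<zeta> \<in> half_square r"
  shows "cmod (h \<zeta>) \<le>
    max \<epsilon> (K * exp (- N * r\<^sup>2)) * exp (N * (2 * r * Im \<zeta> - (Im \<zeta>)\<^sup>2 + (Re \<zeta>)\<^sup>2))"
proof -
  define \<psi> where "\<psi> \<zeta> = 2 * r * Im \<zeta> - (Im \<zeta>)\<^sup>2 + (Re \<zeta>)\<^sup>2" for \<zeta>
  define g where
    "g \<zeta> = h \<zeta> * exp (complex_of_real N * (2 * complex_of_real r * \<i> * \<zeta> - \<zeta>\<^sup>2))" for \<zeta>
  have norm_g: "cmod (g \<zeta>) = cmod (h \<zeta>) * exp (- N * \<psi> \<zeta>)" for \<zeta>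
    by (simp add: g_def norm_mult \<psi>_def power2_eq_square algebra_simps)
  have "cmod (g \<zeta>) \<le> max \<epsilon> (K * exp (- N * r\<^sup>2))"
  proof (rule maximum_modulus_frontier[OF _ _ _ _ \<zeta>])
    show "g holomorphic_on interior (half_square r)"
      unfolding g_def by (intro holomorphic_intros hol)
    show "continuous_on (closure (half_square r)) g"
      unfolding g_def using compact_imp_closed[OF compact_half_square[of r]]
      by (auto intro!: continuous_intros cont simp: closure_closed)
    show "bounded (half_square r)" by (rule compact_imp_bounded[OF compact_half_square])
    fix w assume w: "w \<in> frontier (half_square r)"
    have wR: "w \<in> half_square r"
      using w unfolding half_square_eq_cbox frontier_cbox by blast
    have sides: "Im w = 0 \<or> \<bar>Re w\<bar> = r \<or> Im w = r"
      using w unfolding half_square_eq_cbox frontier_cbox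
      by (auto simp: in_cbox_complex_iff in_box_complex_iff)
    show "cmod (g w) \<le> max \<epsilon> (K * exp (- N * r\<^sup>2))"
    proof (cases "Im w = 0")
      case True
      then have "complex_of_real (Re w) = w" by (simp add: complex_eq_iff)
      then have "cmod (h w) \<le> \<epsilon>"
        using bottom[of "Re w"] wR by (simp add: half_square_def)
      moreover have "exp (- N * \<psi> w) \<le> 1"
        using N True by (simp add: \<psi>_def)
      ultimately have "cmod (h w) * exp (- N * \<psi> w) \<le> \<epsilon> * 1"
        by (intro mult_mono) (auto intro: order_trans[OF norm_ge_zero])
      then show ?thesis by (simp add: norm_g)
    next
      case False
      have "\<psi> w \<ge> r\<^sup>2"
      proof (cases "Im w = r")
        case True
        then show ?thesis by (simp add: \<psi>_def power2_eq_square)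
      next
        case False
        then have "(Re w)\<^sup>2 = r\<^sup>2" using sides \<open>Im w \<noteq> 0\<close> by (metis power2_abs)
        moreover have "0 \<le> Im w * (2 * r - Im w)"
          using wR r by (intro mult_nonneg_nonneg) (auto simp: half_square_def)
        ultimately show ?thesis by (simp add: \<psi>_def power2_eq_square algebra_simps)
      qed
      then have "exp (- N * \<psi> w) \<le> exp (- N * r\<^sup>2)"
        using N by (simp add: mult_left_mono)
      then have "cmod (h w) * exp (- N * \<psi> w) \<le> K * exp (- N * r\<^sup>2)"
        using K[OF wR] by (intro mult_mono) (auto intro: order_trans[OF norm_ge_zero])
      then show ?thesis by (simp add: norm_g)
    qed
  qed
  then have "cmod (h \<zeta>) \<le> max \<epsilon> (K * exp (- N * r\<^sup>2)) / exp (- N * \<psi> \<zeta>)"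
    unfolding norm_g by (simp add: pos_le_divide_eq)
  then show ?thesis by (simp add: \<psi>_def exp_minus divide_inverse)
qed

lemma tendsto_zero_from_above:
  fixes F :: "complex \<Rightarrow> 'h::complex_hilbert"
  assumes r: "r > 0"
    and cont: "\<And>\<eta>. continuous_on (half_square r) (\<lambda>\<zeta>. cinner (F \<zeta>) \<eta>)"
    and hol: "\<And>\<eta>. (\<lambda>\<zeta>. cinner (F \<zeta>) \<eta>) holomorphic_on interior (half_square r)"
    and K: "\<And>\<zeta>. \<zeta> \<in> half_square r \<Longrightarrow> norm (F \<zeta>) \<le> K"
    and line: "isCont (\<lambda>t. F (complex_of_real t)) 0" and F0: "F 0 = 0"
  shows "(F \<longlongrightarrow> 0) (at 0 within {\<zeta>. 0 \<le> Im \<zeta>})"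
proof (rule tendstoI)
  fix e :: real assume e: "e > 0"
  obtain d where d: "d > 0" "\<And>t. \<bar>t\<bar> < d \<Longrightarrow> norm (F (complex_of_real t)) < e / 4"
    using continuous_at_eps_delta[THEN iffD1, OF line] e F0
    by (metis diff_zero dist_norm divide_pos_pos of_real_0 real_norm_def zero_less_numeral)
  define s where "s = min r (d / 2)"
  have s: "0 < s" "s \<le> r" "s < d" using r d(1) by (auto simp: s_def)
  have sub: "half_square s \<subseteq> half_square r" by (rule half_square_mono[OF s(2)])
  have "((\<lambda>N. K * exp (- N * s\<^sup>2)) \<longlongrightarrow> 0) at_top"
    using s(1) by (intro exp_decay) simp
  then have "eventually (\<lambda>N. N \<ge> 0 \<and> K * exp (- N * s\<^sup>2) < e / 4) at_top"
    using e by (intro eventually_conj eventually_ge_at_top order_tendstoD) auto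
  then obtain N where N: "N \<ge> 0" "K * exp (- N * s\<^sup>2) < e / 4"
    using eventually_happens'[OF trivial_limit_at_top_linorder] by blast
  have "((\<lambda>\<zeta>. exp (N * (2 * s * Im \<zeta> - (Im \<zeta>)\<^sup>2 + (Re \<zeta>)\<^sup>2))) \<longlongrightarrow>
      exp (N * (2 * s * Im 0 - (Im 0)\<^sup>2 + (Re 0)\<^sup>2))) (at 0 within {\<zeta>. 0 \<le> Im \<zeta>})"
    by (intro tendsto_intros)
  then have "\<forall>\<^sub>F \<zeta> in at 0 within {\<zeta>. 0 \<le> Im \<zeta>}.
      exp (N * (2 * s * Im \<zeta> - (Im \<zeta>)\<^sup>2 + (Re \<zeta>)\<^sup>2)) < 2"
    by (rule order_tendstoD) simp
  moreover have "\<forall>\<^sub>F \<zeta> in at 0 within {\<zeta>. 0 \<le> Im \<zeta>}. cmod \<zeta> < s"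
    using s(1) unfolding eventually_at by (intro exI[of _ s]) (auto simp: dist_norm)
  moreover have "\<forall>\<^sub>F \<zeta> in at 0 within {\<zeta>. 0 \<le> Im \<zeta>}. 0 \<le> Im \<zeta>"
    by (simp add: eventually_at_filter)
  ultimately show "\<forall>\<^sub>F \<zeta> in at 0 within {\<zeta>. 0 \<le> Im \<zeta>}. dist (F \<zeta>) 0 < e"
  proof eventually_elim
    case (elim \<zeta>)
    define E where "E = exp (N * (2 * s * Im \<zeta> - (Im \<zeta>)\<^sup>2 + (Re \<zeta>)\<^sup>2))"
    have \<zeta>: "\<zeta> \<in> half_square s"
      using elim abs_Re_le_cmod[of \<zeta>] abs_Im_le_cmod[of \<zeta>] by (auto simp: half_square_def)
    define n where "n = norm (F \<zeta>)"
    have "n\<^sup>2 = cmod (cinner (F \<zeta>) (F \<zeta>))" by (simp add: n_def cinner_self norm_power)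
    also have "\<dots> \<le> max (e / 4 * n) (K * n * exp (- N * s\<^sup>2)) * E"
      unfolding E_def
    proof (rule half_square_bound[OF s(1) N(1) _ _ _ _ \<zeta>, where h = "\<lambda>w. cinner (F w) (F \<zeta>)"])
      show "continuous_on (half_square s) (\<lambda>w. cinner (F w) (F \<zeta>))"
        by (rule continuous_on_subset[OF cont sub])
      show "(\<lambda>w. cinner (F w) (F \<zeta>)) holomorphic_on interior (half_square s)"
        by (rule holomorphic_on_subset[OF hol interior_mono[OF sub]])
      show "cmod (cinner (F (complex_of_real t)) (F \<zeta>)) \<le> e / 4 * n" if "\<bar>t\<bar> \<le> s" for t
        using d(2)[of t] that s(3) unfolding n_def
        by (intro order_trans[OF norm_cinner_le] mult_right_mono) auto
      show "cmod (cinner (F w) (F \<zeta>)) \<le> K * n" if "w \<in> half_square s" for w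
        using K that sub unfolding n_def
        by (intro order_trans[OF norm_cinner_le] mult_right_mono) auto
    qed
    also have "\<dots> \<le> e / 4 * n * 2"
    proof (rule mult_mono[OF max.boundedI[OF order_refl]])
      have "K * exp (- N * s\<^sup>2) * n \<le> e / 4 * n"
        using N(2) by (intro mult_right_mono) (auto simp: n_def)
      then show "K * n * exp (- N * s\<^sup>2) \<le> e / 4 * n" by (simp add: mult_ac)
    qed (use elim e in \<open>auto simp: E_def n_def\<close>)
    finally have "n * n \<le> e / 2 * n" by (simp add: power2_eq_square)
    then have "n \<le> e / 2" using e by (cases "n = 0") (auto simp: n_def)
    then show ?case using e by (simp add: n_def)
  qed
qed

lemma affine_image_interior:
  fixes a :: "'a::real_normed_vector"
  assumes "\<sigma> \<noteq> 0" "(\<lambda>\<zeta>. a + \<sigma> *\<^sub>R \<zeta>) ` Q \<subseteq> S"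
  shows "(\<lambda>\<zeta>. a + \<sigma> *\<^sub>R \<zeta>) ` interior Q \<subseteq> interior S"
proof (rule interior_maximal)
  show "(\<lambda>\<zeta>. a + \<sigma> *\<^sub>R \<zeta>) ` interior Q \<subseteq> S"
    using assms(2) interior_subset[of Q] by blast
  show "open ((\<lambda>\<zeta>. a + \<sigma> *\<^sub>R \<zeta>) ` interior Q)"
    by (rule open_affinity[OF open_interior assms(1)])
qed

lemma holomorphic_on_affine:
  fixes a :: complex
  assumes "\<sigma> \<noteq> 0" "(\<lambda>\<zeta>. a + \<sigma> *\<^sub>R \<zeta>) ` Q \<subseteq> S" "h holomorphic_on interior S"
  shows "(\<lambda>\<zeta>. h (a + \<sigma> *\<^sub>R \<zeta>)) holomorphic_on interior Q"
proof -
  have "h \<circ> (\<lambda>\<zeta>. a + \<sigma> *\<^sub>R \<zeta>) holomorphic_on interior Q"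
    unfolding scaleR_conv_of_real
    using affine_image_interior[OF assms(1,2)] assms(3)
    by (intro holomorphic_on_compose_gen[where t = "interior S"] holomorphic_intros)
       (auto simp: scaleR_conv_of_real)
  then show ?thesis by (simp add: o_def)
qed

lemma continuous_on_affine:
  fixes a :: "'a::real_normed_vector"
  assumes "(\<lambda>\<zeta>. a + \<sigma> *\<^sub>R \<zeta>) ` Q \<subseteq> S" "continuous_on S h"
  shows "continuous_on Q (\<lambda>\<zeta>. h (a + \<sigma> *\<^sub>R \<zeta>))"
  by (rule continuous_on_compose2[OF assms(2) _ assms(1)]) (intro continuous_intros)

lemma strip_eq: "z \<notin> \<real> \<Longrightarrow> strip z = {w. min 0 (Im z) \<le> Im w \<and> Im w \<le> max 0 (Im z)}"
  using complex_is_Real_iff[of z]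
  by (cases "Im z > 0") (auto simp: strip_def divide_simps)

lemma zero_on_strip_if_zero_on_reals:
  assumes z: "z \<notin> \<real>"
    and cont: "continuous_on (strip z) h" and hol: "h holomorphic_on interior (strip z)"
    and zero: "\<And>t. h (complex_of_real t) = 0" and w: "w \<in> strip z"
  shows "h w = 0"
proof -
  define r \<sigma> where "r = \<bar>Im z\<bar>" and "\<sigma> = sgn (Im z)"
  have Imz: "Im z \<noteq> 0" using z complex_is_Real_iff by blast
  have r: "r > 0" "\<sigma> \<noteq> 0" using Imz by (auto simp: r_def \<sigma>_def sgn_if)
  have below: "h (Complex a (\<sigma> * b)) = 0" if b: "0 \<le> b" "b < r" for a b
  proof -
    have img: "(\<lambda>\<zeta>. complex_of_real a + \<sigma> *\<^sub>R \<zeta>) ` half_square r \<subseteq> strip z"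
      using Imz by (auto simp: strip_eq[OF z] half_square_def \<sigma>_def r_def sgn_if field_simps)
    define g where "g \<zeta> = h (complex_of_real a + \<sigma> *\<^sub>R \<zeta>)" for \<zeta>
    have cg: "continuous_on (half_square r) g"
      unfolding g_def by (rule continuous_on_affine[OF img cont])
    have hg: "g holomorphic_on interior (half_square r)"
      unfolding g_def by (rule holomorphic_on_affine[OF r(2) img hol])
    have "bounded (g ` half_square r)"
      by (intro compact_imp_bounded compact_continuous_image cg compact_half_square)
    then obtain K where K: "K > 0" "\<And>\<zeta>. \<zeta> \<in> half_square r \<Longrightarrow> cmod (g \<zeta>) \<le> K"
      by (auto simp: bounded_pos)
    have g0: "cmod (g (complex_of_real t)) \<le> 0" for t
      using zero[of "a + \<sigma> * t"] by (simp add: g_def scaleR_conv_of_real)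
    have "cmod (g (Complex 0 b)) \<le> K * exp (- N * (r - b)\<^sup>2)" if N: "N \<ge> 0" for N
    proof -
      have "cmod (g (Complex 0 b)) \<le>
          max 0 (K * exp (- N * r\<^sup>2)) * exp (N * (2 * r * b - b\<^sup>2))"
        using half_square_bound[OF r(1) N cg hg g0 K(2), of "Complex 0 b"] b
        by (simp add: half_square_def)
      also have "\<dots> = K * exp (- N * (r - b)\<^sup>2)"
        using K(1) by (simp add: max_def power2_eq_square algebra_simps flip: exp_add)
      finally show ?thesis .
    qed
    then have "eventually (\<lambda>N. cmod (g (Complex 0 b)) \<le> K * exp (- N * (r - b)\<^sup>2)) at_top"
      by (intro eventually_mono[OF eventually_ge_at_top[of 0]])
    moreover have "((\<lambda>N. K * exp (- N * (r - b)\<^sup>2)) \<longlongrightarrow> 0) at_top"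
      using b by (intro exp_decay) simp
    ultimately have "cmod (g (Complex 0 b)) \<le> 0"
      by (intro tendsto_lowerbound) auto
    moreover have "complex_of_real a + \<sigma> *\<^sub>R Complex 0 b = Complex a (\<sigma> * b)"
      by (simp add: complex_eq_iff)
    ultimately show ?thesis by (simp add: g_def)
  qed
  define b where "b = \<sigma> * Im w"
  have b: "0 \<le> b" "b \<le> r" and wb: "w = Complex (Re w) (\<sigma> * b)"
    using w Imz unfolding b_def
    by (auto simp: strip_eq[OF z] \<sigma>_def r_def sgn_if field_simps complex_eq_iff)
  define q where "q n = 1 - inverse (real (Suc n))" for n
  define W where "W n = Complex (Re w) (\<sigma> * (q n * b))" for n
  have q: "0 \<le> q n" "q n < 1" for n by (auto simp: q_def field_simps)
  have "q \<longlonglongrightarrow> 1 - 0" unfolding q_def by (intro tendsto_intros LIMSEQ_inverse_real_of_nat)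
  then have "W \<longlonglongrightarrow> Complex (Re w) (\<sigma> * ((1 - 0) * b))"
    unfolding W_def by (intro tendsto_intros)
  then have "W \<longlonglongrightarrow> w" using wb by simp
  moreover have lt: "q n * b < r" for n
    using q[of n] b r by (cases "b = 0") (auto intro: less_le_trans[OF mult_strict_right_mono[of "q n" 1 b]])
  moreover have "W n \<in> strip z" for n
    using q[of n] b lt[of n] Imz
    by (auto simp: strip_eq[OF z] W_def \<sigma>_def r_def sgn_if field_simps)
  ultimately have "(\<lambda>n. h (W n)) \<longlonglongrightarrow> h w"
    using w by (intro continuous_on_tendsto_compose[OF cont]) auto
  moreover have "h (W n) = 0" for n
    unfolding W_def using q[of n] b lt[of n] by (intro below) auto
  ultimately show ?thesis by (simp add: LIMSEQ_const_iff)
qed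

section \<open>Weak-star continuous functionals\<close>

lemma cinner_eqI: "(\<And>w. cinner u w = cinner v w) \<Longrightarrow> u = v" for u v :: "'h::complex_hilbert"
proof -
  assume "\<And>w. cinner u w = cinner v w"
  then have "cinner (u - v) (u - v) = 0" by (simp add: cinner.diff_left)
  then show "u = v" by (simp add: cinner_self)
qed

lemma scaleC_0_left: "scaleC 0 v = 0" and scaleC_minus1_left: "scaleC (- 1) v = - v"
  for v :: "'h::complex_hilbert"
  using scaleC_of_real[of 0 v] scaleC_of_real[of "- 1" v] by simp_all

lemma scaleC_op_0: "scaleC_op 0 T = 0" and scaleC_op_minus1: "scaleC_op (- 1) T = - T"
  by (rule blinfun_eqI; simp add: scaleC_op_apply scaleC_0_left scaleC_minus1_left blinfun.minus_left)+

lemma is_adjoint_commute: "is_adjoint T S \<Longrightarrow> is_adjoint S T"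
  unfolding is_adjoint_def by (metis cinner_commute)

lemma is_adjoint_diff:
  "is_adjoint S S' \<Longrightarrow> is_adjoint T T' \<Longrightarrow> is_adjoint (S - T) (S' - T')"
  unfolding is_adjoint_def by (simp add: cinner.diff_left cinner.diff_right blinfun.diff_left)

definition clinear_functional :: "'h::complex_hilbert op set \<Rightarrow> ('h op \<Rightarrow> complex) \<Rightarrow> bool" where
  "clinear_functional M \<phi> \<longleftrightarrow>
     (\<forall>x\<in>M. \<forall>y\<in>M. \<phi> (x + y) = \<phi> x + \<phi> y) \<and> (\<forall>c. \<forall>x\<in>M. \<phi> (scaleC_op c x) = c * \<phi> x)"

lemma clinear_functionalD:
  assumes "clinear_functional M \<phi>" "x \<in> M"
  shows "y \<in> M \<Longrightarrow> \<phi> (x + y) = \<phi> x + \<phi> y" "\<phi> (scaleC_op c x) = c * \<phi> x"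
  using assms by (auto simp: clinear_functional_def)

lemma openin_seminorm_topologyD:
  assumes "openin (seminorm_topology V P) U" "x \<in> U"
    and triangle: "\<And>p x y z. p \<in> P \<Longrightarrow> x \<in> V \<Longrightarrow> y \<in> V \<Longrightarrow> z \<in> V \<Longrightarrow> p (z - x) \<le> p (z - y) + p (y - x)"
  obtains F e where "finite F" "F \<subseteq> P" "e > 0" "{y \<in> V. \<forall>p\<in>F. p (y - x) < e} \<subseteq> U"
proof -
  have "generate_topology_on {{y \<in> V. p (y - x) < e} | p x e. p \<in> P \<and> x \<in> V \<and> e > 0} U"
    using assms(1) unfolding seminorm_topology_def by (rule openin_topology_generated_by)
  then have "x \<in> U \<longrightarrow> (\<exists>F e. finite F \<and> F \<subseteq> P \<and> e > 0 \<and> {y \<in> V. \<forall>p\<in>F. p (y - x) < e} \<subseteq> U)"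
  proof induction
    case Empty
    then show ?case by simp
  next
    case (Int A B)
    show ?case
    proof
      assume "x \<in> A \<inter> B"
      then have x: "x \<in> A" "x \<in> B" by auto
      obtain F e where "finite F" "F \<subseteq> P" "e > 0" "{y \<in> V. \<forall>p\<in>F. p (y - x) < e} \<subseteq> A"
        using mp[OF Int.IH(1) x(1)] by (elim exE conjE)
      moreover obtain G d where "finite G" "G \<subseteq> P" "d > 0" "{y \<in> V. \<forall>p\<in>G. p (y - x) < d} \<subseteq> B"
        using mp[OF Int.IH(2) x(2)] by (elim exE conjE)
      ultimately show "\<exists>F e. finite F \<and> F \<subseteq> P \<and> e > 0 \<and> {y \<in> V. \<forall>p\<in>F. p (y - x) < e} \<subseteq> A \<inter> B"
        by (intro exI[of _ "F \<union> G"] exI[of _ "min e d"]) (simp; blast)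
    qed
  next
    case (UN K)
    show ?case
    proof
      assume "x \<in> \<Union>K"
      then obtain k where k: "k \<in> K" "x \<in> k" by blast
      then obtain F e where "finite F" "F \<subseteq> P" "e > 0" "{y \<in> V. \<forall>p\<in>F. p (y - x) < e} \<subseteq> k"
        using UN.IH by meson
      then show "\<exists>F e. finite F \<and> F \<subseteq> P \<and> e > 0 \<and> {y \<in> V. \<forall>p\<in>F. p (y - x) < e} \<subseteq> \<Union>K"
        using k by (intro exI[of _ F] exI[of _ e] conjI) auto
    qed
  next
    case (Basis s)
    then obtain p a e where s: "s = {y \<in> V. p (y - a) < e}" "p \<in> P" "a \<in> V" by blast
    show ?case
    proof
      assume x: "x \<in> s"
      have "{y \<in> V. \<forall>q\<in>{p}. q (y - x) < e - p (x - a)} \<subseteq> s"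
      proof
        fix y assume "y \<in> {y \<in> V. \<forall>q\<in>{p}. q (y - x) < e - p (x - a)}"
        then show "y \<in> s" using triangle[OF s(2,3), of x y] x by (auto simp: s(1))
      qed
      then show "\<exists>F e. finite F \<and> F \<subseteq> P \<and> e > 0 \<and> {y \<in> V. \<forall>p\<in>F. p (y - x) < e} \<subseteq> s"
        using x s by (intro exI[of _ "{p}"] exI[of _ "e - p (x - a)"]) auto
    qed
  qed
  then show ?thesis using assms(2) that by blast
qed

text \<open>The functionals need not be linear outside of \<open>M\<close>, so this is the usual statement on
  intersections of kernels relative to \<open>M\<close>.\<close>

lemma clinear_functional_linear_combination:
  assumes "finite \<Omega>" "\<And>\<omega>. \<omega> \<in> \<Omega> \<Longrightarrow> clinear_functional M \<omega>"
    and M: "\<And>x y. x \<in> M \<Longrightarrow> y \<in> M \<Longrightarrow> x + y \<in> M" "\<And>c x. x \<in> M \<Longrightarrow> scaleC_op c x \<in> M"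
    and "clinear_functional M \<phi>"
    and "\<And>x. x \<in> M \<Longrightarrow> \<forall>\<omega>\<in>\<Omega>. \<omega> x = 0 \<Longrightarrow> \<phi> x = 0"
  shows "\<exists>c. \<forall>x\<in>M. \<phi> x = (\<Sum>\<omega>\<in>\<Omega>. c \<omega> * \<omega> x)"
  using assms(1,2,5,6)
proof (induction \<Omega> arbitrary: \<phi> rule: finite_induct)
  case empty
  then show ?case by simp
next
  case (insert \<omega>\<^sub>0 \<Omega>)
  note lin = clinear_functionalD[OF insert.prems(1)[OF insertI1]] clinear_functionalD[OF insert.prems(2)]
  show ?case
  proof (cases "\<forall>x\<in>M. (\<forall>\<omega>\<in>\<Omega>. \<omega> x = 0) \<longrightarrow> \<omega>\<^sub>0 x = 0")
    case True
    then have "\<exists>c. \<forall>x\<in>M. \<phi> x = (\<Sum>\<omega>\<in>\<Omega>. c \<omega> * \<omega> x)"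
      using insert.prems by (intro insert.IH) auto
    then obtain c where c: "\<forall>x\<in>M. \<phi> x = (\<Sum>\<omega>\<in>\<Omega>. c \<omega> * \<omega> x)" by blast
    have "(\<Sum>\<omega>\<in>insert \<omega>\<^sub>0 \<Omega>. (c(\<omega>\<^sub>0 := 0)) \<omega> * \<omega> x) = (\<Sum>\<omega>\<in>\<Omega>. c \<omega> * \<omega> x)" for x
      using insert.hyps by (auto intro!: sum.cong)
    then show ?thesis using c by (intro exI[of _ "c(\<omega>\<^sub>0 := 0)"]) auto
  next
    case False
    then obtain v where v: "v \<in> M" "\<forall>\<omega>\<in>\<Omega>. \<omega> v = 0" "\<omega>\<^sub>0 v \<noteq> 0" by blast
    define b where "b = \<phi> v / \<omega>\<^sub>0 v"
    define \<phi>' where "\<phi>' x = \<phi> x - b * \<omega>\<^sub>0 x" for x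
    have "\<exists>c. \<forall>x\<in>M. \<phi>' x = (\<Sum>\<omega>\<in>\<Omega>. c \<omega> * \<omega> x)"
    proof (rule insert.IH)
      show "clinear_functional M \<omega>" if "\<omega> \<in> \<Omega>" for \<omega> using insert.prems that by blast
      show "clinear_functional M \<phi>'"
        using lin unfolding clinear_functional_def \<phi>'_def by (auto simp: algebra_simps)
      fix x assume x: "x \<in> M" "\<forall>\<omega>\<in>\<Omega>. \<omega> x = 0"
      define k where "k = - (\<omega>\<^sub>0 x / \<omega>\<^sub>0 v)"
      have kv: "scaleC_op k v \<in> M" using M v by blast
      have "\<phi> (x + scaleC_op k v) = 0"
      proof (intro insert.prems(3) ballI)
        show "x + scaleC_op k v \<in> M" using M x kv by blast
        fix \<omega> assume \<omega>: "\<omega> \<in> insert \<omega>\<^sub>0 \<Omega>"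
        note l = clinear_functionalD[OF insert.prems(1)[OF \<omega>]]
        have "\<omega> (x + scaleC_op k v) = \<omega> x + k * \<omega> v" using l x v kv by simp
        then show "\<omega> (x + scaleC_op k v) = 0" using \<omega> x v by (auto simp: k_def)
      qed
      moreover have "\<phi> (x + scaleC_op k v) = \<phi> x + k * \<phi> v" using lin x v kv by simp
      ultimately show "\<phi>' x = 0" by (simp add: \<phi>'_def b_def k_def)
    qed
    then obtain c where c: "\<forall>x\<in>M. \<phi>' x = (\<Sum>\<omega>\<in>\<Omega>. c \<omega> * \<omega> x)" by blast
    have "(\<Sum>\<omega>\<in>insert \<omega>\<^sub>0 \<Omega>. (c(\<omega>\<^sub>0 := b)) \<omega> * \<omega> x) = b * \<omega>\<^sub>0 x + (\<Sum>\<omega>\<in>\<Omega>. c \<omega> * \<omega> x)" for x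
      using insert.hyps by (auto intro!: sum.cong)
    then show ?thesis using c by (intro exI[of _ "c(\<omega>\<^sub>0 := b)"]) (auto simp: \<phi>'_def algebra_simps)
  qed
qed

lemma predual_vector_functional: "(\<lambda>T. cinner (blinfun_apply T v) w) \<in> predual M"
proof -
  define \<xi> where "\<xi> u n = (if n = 0 then u else 0)" for u :: 'a and n :: nat
  have "(\<lambda>n. (norm (\<xi> u n))\<^sup>2) sums (norm u)\<^sup>2" for u
    using sums_single[of "0 :: nat" "\<lambda>_. (norm u)\<^sup>2"]
    by (rule back_subst[of "\<lambda>g. g sums _"]) (auto simp: \<xi>_def)
  moreover have "(\<lambda>n. cinner (blinfun_apply T (\<xi> v n)) (\<xi> w n)) sums cinner (blinfun_apply T v) w" for T
    using sums_single[of "0 :: nat" "\<lambda>_. cinner (blinfun_apply T v) w"]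
    by (rule back_subst[of "\<lambda>g. g sums _"]) (auto simp: \<xi>_def)
  ultimately show ?thesis
    unfolding predual_def mem_Collect_eq
    by (intro exI[of _ "\<xi> v"] exI[of _ "\<xi> w"] conjI ballI) (auto intro: sums_summable)
qed

context
  fixes M :: "'h::complex_hilbert op set"
  assumes vN: "von_neumann_algebra M"
begin

lemma
  shows vna_add: "x \<in> M \<Longrightarrow> y \<in> M \<Longrightarrow> x + y \<in> M"
    and vna_scaleC: "x \<in> M \<Longrightarrow> scaleC_op c x \<in> M"
    and vna_comp: "x \<in> M \<Longrightarrow> y \<in> M \<Longrightarrow> x o\<^sub>L y \<in> M"
  using vN by (auto simp: von_neumann_algebra_def)

lemma vna_zero: "0 \<in> M"
  using vN vna_scaleC[of id_blinfun 0] by (simp add: von_neumann_algebra_def scaleC_op_0)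

lemma vna_diff: "x \<in> M \<Longrightarrow> y \<in> M \<Longrightarrow> x - y \<in> M"
  using vna_add[of x "- y"] vna_scaleC[of y "- 1"] by (simp add: scaleC_op_minus1)

lemma
  assumes "x \<in> M"
  shows vna_adj: "adj x \<in> M" and vna_is_adjoint: "is_adjoint x (adj x)"
proof -
  obtain y where "y \<in> M" "is_adjoint x y" using assms vN by (auto simp: von_neumann_algebra_def)
  then show "adj x \<in> M" "is_adjoint x (adj x)" using adj_eqI by auto
qed

lemma vna_cinner_adj: "x \<in> M \<Longrightarrow> cinner (adj x v) w = cinner v (x w)"
  using is_adjoint_commute[OF vna_is_adjoint] by (simp add: is_adjoint_def)

lemma vna_adj_adj: "x \<in> M \<Longrightarrow> adj (adj x) = x"
  by (rule adj_eqI[OF is_adjoint_commute[OF vna_is_adjoint]])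

lemma vna_adj_diff: "x \<in> M \<Longrightarrow> y \<in> M \<Longrightarrow> adj (x - y) = adj x - adj y"
  by (rule adj_eqI[OF is_adjoint_diff[OF vna_is_adjoint vna_is_adjoint]])

lemma clinear_functional_predual:
  assumes "\<omega> \<in> predual M"
  shows "clinear_functional M \<omega>"
proof -
  obtain \<xi> \<eta> :: "nat \<Rightarrow> 'h"
    where s: "\<And>x. x \<in> M \<Longrightarrow> (\<lambda>n. cinner (blinfun_apply x (\<xi> n)) (\<eta> n)) sums \<omega> x"
    using assms unfolding predual_def by blast
  show ?thesis
    unfolding clinear_functional_def
  proof (intro conjI ballI allI)
    fix x y assume "x \<in> M" "y \<in> M"
    then show "\<omega> (x + y) = \<omega> x + \<omega> y"
      using sums_add[OF s s, of x y]
      by (intro sums_unique2[OF s[OF vna_add]]) (simp_all add: blinfun.add_left cinner_add_left)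
  next
    fix c x assume "x \<in> M"
    then show "\<omega> (scaleC_op c x) = c * \<omega> x"
      using sums_mult[OF s, of x c]
      by (intro sums_unique2[OF s[OF vna_scaleC]]) (simp_all add: scaleC_op_apply cinner_scaleC_left)
  qed
qed

lemma predual_zero: "\<omega> \<in> predual M \<Longrightarrow> \<omega> 0 = 0"
  using clinear_functionalD(2)[OF clinear_functional_predual vna_zero, of \<omega> 0]
  by (simp add: scaleC_op_0)

lemma predual_add: "\<omega> \<in> predual M \<Longrightarrow> x \<in> M \<Longrightarrow> y \<in> M \<Longrightarrow> \<omega> (x + y) = \<omega> x + \<omega> y"
  by (rule clinear_functionalD[OF clinear_functional_predual])

lemma predual_diff: "\<omega> \<in> predual M \<Longrightarrow> x \<in> M \<Longrightarrow> y \<in> M \<Longrightarrow> \<omega> (x - y) = \<omega> x - \<omega> y"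
  using predual_add[of \<omega> "x - y" y] vna_diff[of x y] by simp

lemma predual_cnj_adj:
  assumes "\<omega> \<in> predual M"
  shows "(\<lambda>x. cnj (\<omega> (adj x))) \<in> predual M"
proof -
  obtain \<xi> \<eta> :: "nat \<Rightarrow> 'h"
    where "summable (\<lambda>n. (norm (\<xi> n))\<^sup>2)" "summable (\<lambda>n. (norm (\<eta> n))\<^sup>2)"
      and s: "\<And>x. x \<in> M \<Longrightarrow> (\<lambda>n. cinner (blinfun_apply x (\<xi> n)) (\<eta> n)) sums \<omega> x"
    using assms unfolding predual_def by blast
  moreover have "(\<lambda>n. cinner (blinfun_apply x (\<eta> n)) (\<xi> n)) sums cnj (\<omega> (adj x))" if "x \<in> M" for x
    using sums_cnj[THEN iffD2, OF s[OF vna_adj[OF that]]] vna_cinner_adj[OF that]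
    by (simp add: cinner_commute[of "blinfun_apply x _"])
  ultimately show ?thesis
    unfolding predual_def by blast
qed

lemma openin_weak_star_functional:
  assumes "\<omega> \<in> predual M" "x \<in> M" "e > 0"
  shows "openin (weak_star_topology M) {y \<in> M. cmod (\<omega> y - \<omega> x) < e}"
proof -
  have "{y \<in> M. cmod (\<omega> y - \<omega> x) < e} = {y \<in> M. cmod (\<omega> (y - x)) < e}"
    using assms by (auto simp: predual_diff)
  also have "openin (weak_star_topology M) \<dots>"
    unfolding weak_star_topology_def seminorm_topology_def
    using assms
    by (intro topology_generated_by_Basis CollectI exI[of _ "\<lambda>x. cmod (\<omega> x)"] exI[of _ x] exI[of _ e]) auto
  finally show ?thesis .
qed

lemma continuous_on_predual:
  fixes S :: "'a::metric_space set"
  assumes "continuous_map (top_of_set S) (weak_star_topology M) f" "\<omega> \<in> predual M"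
  shows "continuous_on S (\<lambda>w. \<omega> (f w))"
  unfolding continuous_on_iff
proof (intro ballI allI impI)
  fix a and e :: real assume a: "a \<in> S" and e: "e > 0"
  have fM: "f w \<in> M" if "w \<in> S" for w
    using continuous_map_image_subset_topspace[OF assms(1)] that
    by (auto simp: topspace_weak_star)
  have "openin (top_of_set S) {w \<in> S. f w \<in> {y \<in> M. cmod (\<omega> y - \<omega> (f a)) < e}}"
    using openin_continuous_map_preimage[OF assms(1) openin_weak_star_functional[OF assms(2) fM[OF a] e]]
    by simp
  then show "\<exists>d>0. \<forall>w\<in>S. dist w a < d \<longrightarrow> dist (\<omega> (f w)) (\<omega> (f a)) < e"
    unfolding openin_euclidean_subtopology_iff using a e fM by (fastforce simp: dist_norm)
qed

lemma weak_star_continuous_functional: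
  assumes lin: "clinear_functional M \<phi>"
    and op: "openin (weak_star_topology M) {x \<in> M. cmod (\<phi> x) < 1}"
  obtains \<Omega> c where "finite \<Omega>" "\<Omega> \<subseteq> predual M" "\<And>x. x \<in> M \<Longrightarrow> \<phi> x = (\<Sum>\<omega>\<in>\<Omega>. c \<omega> * \<omega> x)"
proof -
  have "\<phi> 0 = 0" using clinear_functionalD(2)[OF lin vna_zero, of 0] by (simp add: scaleC_op_0)
  then have 0: "0 \<in> {x \<in> M. cmod (\<phi> x) < 1}" using vna_zero by simp
  let ?P = "{\<lambda>x. cmod (\<omega> x) | \<omega>. \<omega> \<in> predual M}"
  obtain F e where F: "finite F" "F \<subseteq> ?P" and e: "e > 0"
    "{y \<in> M. \<forall>p\<in>F. p (y - 0) < e} \<subseteq> {x \<in> M. cmod (\<phi> x) < 1}"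
  proof (rule openin_seminorm_topologyD[OF op[unfolded weak_star_topology_def] 0])
    fix p x y z assume "p \<in> ?P" and M: "x \<in> M" "y \<in> M" "z \<in> M"
    then obtain \<omega> where \<omega>: "p = (\<lambda>x. cmod (\<omega> x))" "\<omega> \<in> predual M" by blast
    show "p (z - x) \<le> p (z - y) + p (y - x)"
      using norm_triangle_ineq[of "\<omega> z - \<omega> y" "\<omega> y - \<omega> x"] M
      by (simp add: \<omega>(1) predual_diff[OF \<omega>(2)])
  qed blast
  have "F \<subseteq> (\<lambda>\<omega> x. cmod (\<omega> x)) ` predual M" using F(2) by (simp add: Setcompr_eq_image)
  from finite_subset_image[OF F(1) this] obtain \<Omega> where \<Omega>: "\<Omega> \<subseteq> predual M" "finite \<Omega>" "F = (\<lambda>\<omega> x. cmod (\<omega> x)) ` \<Omega>"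
    by (elim exE conjE)
  have "\<exists>c. \<forall>x\<in>M. \<phi> x = (\<Sum>\<omega>\<in>\<Omega>. c \<omega> * \<omega> x)"
  proof (rule clinear_functional_linear_combination[OF \<Omega>(2) _ vna_add vna_scaleC lin])
    show "clinear_functional M \<omega>" if "\<omega> \<in> \<Omega>" for \<omega>
      using \<Omega>(1) that by (blast intro: clinear_functional_predual)
    fix x assume x: "x \<in> M" "\<forall>\<omega>\<in>\<Omega>. \<omega> x = 0"
    have small: "cmod (a * \<phi> x) < 1" for a
    proof -
      have "cmod (\<omega> (scaleC_op a x)) < e" if "\<omega> \<in> \<Omega>" for \<omega>
        using clinear_functionalD(2)[OF clinear_functional_predual x(1), of \<omega> a] that \<Omega>(1) bspec[OF x(2) that] e(1)
        by (simp add: subset_iff)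
      then have "scaleC_op a x \<in> {y \<in> M. \<forall>p\<in>F. p (y - 0) < e}"
        using vna_scaleC[OF x(1)] by (auto simp: \<Omega>(3))
      then show ?thesis using e(2) clinear_functionalD(2)[OF lin x(1)] by force
    qed
    show "\<phi> x = 0" using small[of "1 / \<phi> x"] by (cases "\<phi> x = 0") auto
  qed
  then show ?thesis using that \<Omega> by blast
qed

lemma predual_automorphism:
  assumes aut: "star_automorphism M \<theta>"
    and cont: "continuous_map (weak_star_topology M) (weak_star_topology M) \<theta>"
    and \<omega>: "\<omega> \<in> predual M"
  obtains \<Omega> c where "finite \<Omega>" "\<Omega> \<subseteq> predual M" "\<And>x. x \<in> M \<Longrightarrow> \<omega> (\<theta> x) = (\<Sum>\<omega>\<in>\<Omega>. c \<omega> * \<omega> x)"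
proof (rule weak_star_continuous_functional)
  have \<theta>: "\<theta> x \<in> M" if "x \<in> M" for x
    using aut that by (auto simp: star_automorphism_def bij_betw_def)
  show "clinear_functional M (\<lambda>x. \<omega> (\<theta> x))"
    using aut \<theta> clinear_functionalD[OF clinear_functional_predual[OF \<omega>]]
    by (auto simp: star_automorphism_def clinear_functional_def)
  have "{x \<in> M. cmod (\<omega> (\<theta> x)) < 1} = {x \<in> topspace (weak_star_topology M). \<theta> x \<in> {y \<in> M. cmod (\<omega> y - \<omega> 0) < 1}}"
    using \<theta> by (auto simp: topspace_weak_star predual_zero[OF \<omega>])
  then show "openin (weak_star_topology M) {x \<in> M. cmod (\<omega> (\<theta> x)) < 1}"
    using openin_continuous_map_preimage[OF cont openin_weak_star_functional[OF \<omega> vna_zero, of 1]] by simp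
qed blast

end

section \<open>Strong continuity of regular extensions\<close>

lemma closed_strip: "closed (strip z)"
proof (cases "z \<in> \<real>")
  case True
  then show ?thesis by (simp add: strip_def closed_complex_Reals)
next
  case False
  then show ?thesis
    unfolding strip_eq[OF False] by (intro closed_Collect_conj closed_Collect_le continuous_intros)
qed

lemma of_real_in_strip: "complex_of_real t \<in> strip z"
  by (simp add: strip_def)

lemma strip_add_real: "w \<in> strip z \<Longrightarrow> complex_of_real t + w \<in> strip z"
  by (auto simp: strip_def split: if_splits)

lemma bounded_on_compact:
  fixes T :: "'b::topological_space \<Rightarrow> 'h::complex_hilbert op"
  assumes "compact C" "\<And>v w. continuous_on C (\<lambda>a. cinner (T a v) w)"
  obtains K where "K > 0" "\<And>a. a \<in> C \<Longrightarrow> norm (T a) \<le> K"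
proof (rule norm_bounded_if_weakly_bounded[of C T])
  fix v w
  have "bounded ((\<lambda>a. cinner (T a v) w) ` C)"
    by (intro compact_imp_bounded compact_continuous_image assms)
  then show "\<exists>K. \<forall>a\<in>C. cmod (cinner (T a v) w) \<le> K" by (auto simp: bounded_iff)
qed blast

lemma continuous_on_if_continuous_on_compact:
  fixes g :: "'a::heine_borel \<Rightarrow> 'b::topological_space"
  assumes "closed S" "\<And>C. compact C \<Longrightarrow> C \<subseteq> S \<Longrightarrow> continuous_on C g"
  shows "continuous_on S g"
  unfolding continuous_on_def
proof
  fix a assume a: "a \<in> S"
  have "continuous_on (S \<inter> cball a 1) g"
    using assms(1) by (intro assms(2) closed_Int_compact) auto
  then have "(g \<longlongrightarrow> g a) (at a within S \<inter> cball a 1)"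
    using a by (auto simp: continuous_on_def)
  moreover have "at a within S \<inter> cball a 1 = at a within S"
    by (rule at_within_nhd[of _ "ball a 1"]) auto
  ultimately show "(g \<longlongrightarrow> g a) (at a within S)" by simp
qed

lemma one_sided_tendsto_on_strip:
  fixes f :: "complex \<Rightarrow> 'h::complex_hilbert op"
  assumes z: "z \<notin> \<real>"
    and cont: "\<And>\<eta>. continuous_on (strip z) (\<lambda>w. cinner (f w v) \<eta>)"
    and hol: "\<And>\<eta>. (\<lambda>w. cinner (f w v) \<eta>) holomorphic_on interior (strip z)"
    and bounded: "\<And>C. compact C \<Longrightarrow> C \<subseteq> strip z \<Longrightarrow> \<exists>K. \<forall>w\<in>C. norm (f w v) \<le> K"
    and line: "isCont (\<lambda>t. f (w\<^sub>0 + complex_of_real t) v) 0"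
    and w\<^sub>0: "w\<^sub>0 \<in> strip z" and \<sigma>: "\<bar>\<sigma>\<bar> = (1::real)"
  shows "((\<lambda>w. f w v) \<longlongrightarrow> f w\<^sub>0 v) (at w\<^sub>0 within {w \<in> strip z. 0 \<le> \<sigma> * (Im w - Im w\<^sub>0)})"
    (is "(_ \<longlongrightarrow> _) (at _ within ?H)")
proof (cases "\<exists>w\<^sub>1\<in>strip z. 0 < \<sigma> * (Im w\<^sub>1 - Im w\<^sub>0)")
  case True
  then obtain w\<^sub>1 where w\<^sub>1: "w\<^sub>1 \<in> strip z" "0 < \<sigma> * (Im w\<^sub>1 - Im w\<^sub>0)" by blast
  define r where "r = \<sigma> * (Im w\<^sub>1 - Im w\<^sub>0)"
  have \<sigma>_cases: "\<sigma> = 1 \<or> \<sigma> = -1" using \<sigma> by linarith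
  then have \<sigma>0: "\<sigma> \<noteq> 0" by auto
  have img: "(\<lambda>\<zeta>. w\<^sub>0 + \<sigma> *\<^sub>R \<zeta>) ` half_square r \<subseteq> strip z"
    using \<sigma>_cases w\<^sub>0 w\<^sub>1 by (auto simp: strip_eq[OF z] half_square_def r_def)
  define F where "F \<zeta> = f (w\<^sub>0 + \<sigma> *\<^sub>R \<zeta>) v - f w\<^sub>0 v" for \<zeta>
  have "compact ((\<lambda>\<zeta>. w\<^sub>0 + \<sigma> *\<^sub>R \<zeta>) ` half_square r)"
    by (intro compact_continuous_image compact_half_square continuous_intros)
  then obtain K where K: "\<And>\<zeta>. \<zeta> \<in> half_square r \<Longrightarrow> norm (f (w\<^sub>0 + \<sigma> *\<^sub>R \<zeta>) v) \<le> K"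
    using bounded[OF _ img] by auto
  have "(F \<longlongrightarrow> 0) (at 0 within {\<zeta>. 0 \<le> Im \<zeta>})"
  proof (rule tendsto_zero_from_above)
    show "r > 0" using w\<^sub>1 by (simp add: r_def)
    show "continuous_on (half_square r) (\<lambda>\<zeta>. cinner (F \<zeta>) \<eta>)" for \<eta>
      unfolding F_def cinner.diff_left
      by (intro continuous_intros continuous_on_affine[OF img cont])
    show "(\<lambda>\<zeta>. cinner (F \<zeta>) \<eta>) holomorphic_on interior (half_square r)" for \<eta>
      unfolding F_def cinner.diff_left
      by (intro holomorphic_intros holomorphic_on_affine[OF \<sigma>0 img hol])
    show "norm (F \<zeta>) \<le> K + norm (f w\<^sub>0 v)" if "\<zeta> \<in> half_square r" for \<zeta>
      unfolding F_def using K[OF that] by (intro order_trans[OF norm_triangle_ineq4]) simp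
    have "isCont (\<lambda>t. f (w\<^sub>0 + complex_of_real (\<sigma> * t)) v) 0"
      using line
      by (intro isCont_o2[where f = "\<lambda>t. \<sigma> * t" and g = "\<lambda>t. f (w\<^sub>0 + complex_of_real t) v"]) simp_all
    then show "isCont (\<lambda>t. F (complex_of_real t)) 0"
      unfolding F_def by (intro isCont_diff continuous_const) (simp add: scaleR_conv_of_real)
    show "F 0 = 0" by (simp add: F_def)
  qed
  moreover have "filterlim (\<lambda>w. \<sigma> *\<^sub>R (w - w\<^sub>0)) (at 0 within {\<zeta>. 0 \<le> Im \<zeta>}) (at w\<^sub>0 within ?H)"
    unfolding filterlim_at
  proof
    show "\<forall>\<^sub>F w in at w\<^sub>0 within ?H. \<sigma> *\<^sub>R (w - w\<^sub>0) \<in> {\<zeta>. 0 \<le> Im \<zeta>} \<and> \<sigma> *\<^sub>R (w - w\<^sub>0) \<noteq> 0"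
      using \<sigma>0 by (auto simp: eventually_at_filter)
    have "((\<lambda>w. \<sigma> *\<^sub>R (w - w\<^sub>0)) \<longlongrightarrow> \<sigma> *\<^sub>R (w\<^sub>0 - w\<^sub>0)) (at w\<^sub>0 within ?H)"
      by (intro tendsto_intros)
    then show "((\<lambda>w. \<sigma> *\<^sub>R (w - w\<^sub>0)) \<longlongrightarrow> 0) (at w\<^sub>0 within ?H)" by simp
  qed
  ultimately have "((\<lambda>w. F (\<sigma> *\<^sub>R (w - w\<^sub>0))) \<longlongrightarrow> 0) (at w\<^sub>0 within ?H)"
    by (rule filterlim_compose)
  moreover have "F (\<sigma> *\<^sub>R (w - w\<^sub>0)) = f w v - f w\<^sub>0 v" for w
    using \<sigma>_cases by (auto simp: F_def)
  ultimately show ?thesis by (simp add: LIM_zero_iff)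
next
  case False
  then have flat: "w = w\<^sub>0 + complex_of_real (Re w - Re w\<^sub>0)" if "w \<in> ?H" for w
    using that \<sigma> by (fastforce simp: complex_eq_iff)
  have "((\<lambda>w. Re w - Re w\<^sub>0) \<longlongrightarrow> Re w\<^sub>0 - Re w\<^sub>0) (at w\<^sub>0 within ?H)"
    by (intro tendsto_intros)
  then have "((\<lambda>w. f (w\<^sub>0 + complex_of_real (Re w - Re w\<^sub>0)) v) \<longlongrightarrow> f (w\<^sub>0 + complex_of_real 0) v) (at w\<^sub>0 within ?H)"
    by (intro isCont_tendsto_compose[OF line]) simp
  moreover have "\<forall>\<^sub>F w in at w\<^sub>0 within ?H. f (w\<^sub>0 + complex_of_real (Re w - Re w\<^sub>0)) v = f w v"
    unfolding eventually_at_filter using flat by (intro always_eventually) metis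
  ultimately show ?thesis by (auto intro: Lim_transform_eventually)
qed

lemma continuous_on_if_from_above_and_below:
  fixes g :: "complex \<Rightarrow> 'a::topological_space"
  assumes "\<And>w\<^sub>0 \<sigma>. w\<^sub>0 \<in> S \<Longrightarrow> \<bar>\<sigma>\<bar> = 1 \<Longrightarrow>
    (g \<longlongrightarrow> g w\<^sub>0) (at w\<^sub>0 within {w \<in> S. 0 \<le> \<sigma> * (Im w - Im w\<^sub>0)})"
  shows "continuous_on S g"
  unfolding continuous_on_def
proof
  fix w\<^sub>0 assume w\<^sub>0: "w\<^sub>0 \<in> S"
  let ?H = "\<lambda>\<sigma>. {w \<in> S. 0 \<le> \<sigma> * (Im w - Im w\<^sub>0)}"
  have "(g \<longlongrightarrow> g w\<^sub>0) (at w\<^sub>0 within ?H 1 \<union> ?H (- 1))"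
    unfolding Lim_within_Un by (intro conjI assms w\<^sub>0) simp_all
  moreover have "?H 1 \<union> ?H (- 1) = S" by auto
  ultimately show "(g \<longlongrightarrow> g w\<^sub>0) (at w\<^sub>0 within S)" by (simp only:)
qed

lemma continuous_map_seminorm_topology:
  assumes "topspace (seminorm_topology V P) = V" "f ` S \<subseteq> V"
    and "\<And>p x. p \<in> P \<Longrightarrow> x \<in> V \<Longrightarrow> continuous_on S (\<lambda>w. p (f w - x))"
  shows "continuous_map (top_of_set S) (seminorm_topology V P) f"
  unfolding seminorm_topology_def
proof (rule continuous_on_generated_topo)
  fix U assume "U \<in> {{y \<in> V. p (y - x) < e} |p x e. p \<in> P \<and> x \<in> V \<and> e > 0}"
  then obtain p x e where U: "U = {y \<in> V. p (y - x) < e}" "p \<in> P" "x \<in> V" by blast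
  have "openin (top_of_set S) (S \<inter> (\<lambda>w. p (f w - x)) -` {..<e})"
    by (rule continuous_openin_preimage_gen[OF assms(3)[OF U(2,3)] open_lessThan])
  moreover have "f -` U \<inter> topspace (top_of_set S) = S \<inter> (\<lambda>w. p (f w - x)) -` {..<e}"
    using assms(2) by (auto simp: U(1))
  ultimately show "openin (top_of_set S) (f -` U \<inter> topspace (top_of_set S))" by simp
next
  show "f ` topspace (top_of_set S) \<subseteq> \<Union>{{y \<in> V. p (y - x) < e} |p x e. p \<in> P \<and> x \<in> V \<and> e > 0}"
    using assms(1,2) unfolding seminorm_topology_def topology_generated_by_topspace by simp
qed

context
  fixes M :: "'h::complex_hilbert op set"
  assumes vN: "von_neumann_algebra M"
begin

lemma continuous_on_predual_adj_comp:
  fixes T :: "'b::heine_borel \<Rightarrow> 'h op"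
  assumes S: "closed S" and T: "\<And>a. a \<in> S \<Longrightarrow> T a \<in> M"
    and cont: "\<And>v. continuous_on S (\<lambda>a. T a v)" and \<omega>: "\<omega> \<in> predual M"
  shows "continuous_on S (\<lambda>a. \<omega> (adj (T a) o\<^sub>L T a))"
proof (rule continuous_on_if_continuous_on_compact[OF S])
  fix C assume C: "compact C" "C \<subseteq> S"
  obtain \<xi> \<eta> :: "nat \<Rightarrow> 'h"
    where sq: "summable (\<lambda>n. (norm (\<xi> n))\<^sup>2)" "summable (\<lambda>n. (norm (\<eta> n))\<^sup>2)"
      and s: "\<And>x. x \<in> M \<Longrightarrow> (\<lambda>n. cinner (blinfun_apply x (\<xi> n)) (\<eta> n)) sums \<omega> x"
    using \<omega> unfolding predual_def by blast
  have contC: "continuous_on C (\<lambda>a. T a v)" for v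
    by (rule continuous_on_subset[OF cont C(2)])
  obtain K where K: "K > 0" "\<And>a. a \<in> C \<Longrightarrow> norm (T a) \<le> K"
    using bounded_on_compact[OF C(1), of T]
      cinner.continuous_on[OF contC continuous_on_const] by blast
  define t where "t n a = cinner (T a (\<xi> n)) (T a (\<eta> n))" for n a
  have eq: "\<omega> (adj (T a) o\<^sub>L T a) = (\<Sum>n. t n a)" if "a \<in> C" for a
  proof -
    have TM: "T a \<in> M" using C(2) that T by blast
    then have "adj (T a) o\<^sub>L T a \<in> M" by (intro vna_comp[OF vN] vna_adj[OF vN])
    from s[OF this] show ?thesis
      by (auto simp: t_def vna_cinner_adj[OF vN TM] dest: sums_unique)
  qed
  have "uniform_limit C (\<lambda>n a. \<Sum>i<n. t i a) (\<lambda>a. suminf (\<lambda>i. t i a)) sequentially"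
  proof (rule Weierstrass_m_test)
    show "summable (\<lambda>n. K\<^sup>2 * ((norm (\<xi> n))\<^sup>2 + (norm (\<eta> n))\<^sup>2))"
      by (intro summable_mult summable_add sq)
    fix n a assume a: "a \<in> C"
    have bd: "norm (T a v) \<le> K * norm v" for v
      using norm_blinfun[of "T a" v] K(2)[OF a] by (meson mult_right_mono norm_ge_zero order_trans)
    have "norm (t n a) \<le> (K * norm (\<xi> n)) * (K * norm (\<eta> n))"
      unfolding t_def using K(1) by (intro order_trans[OF norm_cinner_le] mult_mono bd) auto
    also have "\<dots> \<le> K\<^sup>2 * ((norm (\<xi> n))\<^sup>2 + (norm (\<eta> n))\<^sup>2)"
    proof -
      have "2 * (norm (\<xi> n) * norm (\<eta> n)) \<le> (norm (\<xi> n))\<^sup>2 + (norm (\<eta> n))\<^sup>2"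
        using sum_squares_bound[of "norm (\<xi> n)" "norm (\<eta> n)"] by (simp add: mult_ac)
      moreover have "0 \<le> norm (\<xi> n) * norm (\<eta> n)" by simp
      ultimately have "K\<^sup>2 * (norm (\<xi> n) * norm (\<eta> n)) \<le> K\<^sup>2 * ((norm (\<xi> n))\<^sup>2 + (norm (\<eta> n))\<^sup>2)"
        by (intro mult_left_mono) (linarith, simp)
      then show ?thesis by (simp add: power2_eq_square mult_ac)
    qed
    finally show "norm (t n a) \<le> K\<^sup>2 * ((norm (\<xi> n))\<^sup>2 + (norm (\<eta> n))\<^sup>2)" .
  qed
  then have "continuous_on C (\<lambda>a. \<Sum>n. t n a)"
    by (rule uniform_limit_theorem[rotated])
       (auto simp: t_def intro!: always_eventually continuous_on_sum cinner.continuous_on contC)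
  then show "continuous_on C (\<lambda>a. \<omega> (adj (T a) o\<^sub>L T a))"
    by (rule continuous_on_eq) (simp add: eq)
qed

context
  fixes \<alpha> :: "real \<Rightarrow> 'h op \<Rightarrow> 'h op"
  assumes group: "weak_star_automorphism_group M \<alpha>"
begin

lemma group_closed: "y \<in> M \<Longrightarrow> \<alpha> t y \<in> M"
  using group unfolding weak_star_automorphism_group_def star_automorphism_def
  by (blast dest: bij_betw_apply)

lemma
  assumes "y \<in> M"
  shows group_add: "\<alpha> (t + s) y = \<alpha> t (\<alpha> s y)"
    and group_adj: "\<alpha> t (adj y) = adj (\<alpha> t y)"
    and group_comp: "x \<in> M \<Longrightarrow> \<alpha> t (x o\<^sub>L y) = \<alpha> t x o\<^sub>L \<alpha> t y"
  using group assms
  by (auto simp: weak_star_automorphism_group_def star_automorphism_def bij_betw_def)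

lemma continuous_on_group_predual:
  assumes "y \<in> M" "\<omega> \<in> predual M"
  shows "continuous_on UNIV (\<lambda>t. \<omega> (\<alpha> t y))"
  using group assms continuous_on_predual[OF vN, of UNIV "\<lambda>t. \<alpha> t y"]
  by (simp add: weak_star_automorphism_group_def)

lemma continuous_on_group_strong:
  assumes y: "y \<in> M"
  shows "continuous_on UNIV (\<lambda>t. \<alpha> t y v)"
  unfolding continuous_on_def
proof
  fix s
  define u where "u = \<alpha> s y v"
  have lim: "((\<lambda>t. cinner (\<alpha> t a p) q) \<longlongrightarrow> cinner (\<alpha> s a p) q) (at s)" if "a \<in> M" for a p q
    using continuous_on_group_predual[OF that predual_vector_functional]
    by (simp add: continuous_on_def)
  have sq: "cinner (\<alpha> t y v) (\<alpha> t y v) = cinner (\<alpha> t (adj y o\<^sub>L y) v) v" for t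
    using vna_cinner_adj[OF vN group_closed[OF y]]
    by (simp add: group_comp[OF y vna_adj[OF vN y]] group_adj[OF y])
  have "(norm (\<alpha> t y v - u))\<^sup>2 = Re (cinner (\<alpha> t (adj y o\<^sub>L y) v) v) - 2 * Re (cinner (\<alpha> t y v) u) + (norm u)\<^sup>2" for t
  proof -
    have "(norm (\<alpha> t y v - u))\<^sup>2 = Re (cinner (\<alpha> t y v - u) (\<alpha> t y v - u))"
      by (simp add: cinner_self)
    also have "\<dots> = Re (cinner (\<alpha> t y v) (\<alpha> t y v)) - Re (cinner (\<alpha> t y v) u) - Re (cinner u (\<alpha> t y v)) + Re (cinner u u)"
      by (simp add: cinner.diff_left cinner.diff_right)
    also have "Re (cinner u (\<alpha> t y v)) = Re (cinner (\<alpha> t y v) u)"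
      by (subst cinner_commute) simp
    finally show ?thesis unfolding sq by (simp add: cinner_self)
  qed
  moreover have "((\<lambda>t. Re (cinner (\<alpha> t (adj y o\<^sub>L y) v) v) - 2 * Re (cinner (\<alpha> t y v) u) + (norm u)\<^sup>2)
      \<longlongrightarrow> Re (cinner (\<alpha> s (adj y o\<^sub>L y) v) v) - 2 * Re (cinner (\<alpha> s y v) u) + (norm u)\<^sup>2) (at s)"
    by (intro tendsto_intros lim vna_comp[OF vN] vna_adj[OF vN] y)
  moreover have "Re (cinner (\<alpha> s (adj y o\<^sub>L y) v) v) - 2 * Re (cinner (\<alpha> s y v) u) + (norm u)\<^sup>2 = 0"
    unfolding sq[symmetric] u_def by (simp add: cinner_self)
  ultimately have "((\<lambda>t. (norm (\<alpha> t y v - u))\<^sup>2) \<longlongrightarrow> 0) (at s)" by simp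
  then have "((\<lambda>t. sqrt ((norm (\<alpha> t y v - u))\<^sup>2)) \<longlongrightarrow> sqrt 0) (at s)" by (rule tendsto_real_sqrt)
  then have "((\<lambda>t. norm (\<alpha> t y v - u)) \<longlongrightarrow> 0) (at s)" by simp
  then show "((\<lambda>t. \<alpha> t y v) \<longlongrightarrow> \<alpha> s y v) (at s)"
    unfolding u_def by (simp add: tendsto_norm_zero_iff LIM_zero_iff)
qed

lemma strongly_continuous_extension:
  fixes f :: "complex \<Rightarrow> 'h op"
  assumes x: "x \<in> M"
    and fM: "\<And>w. w \<in> strip z \<Longrightarrow> f w \<in> M"
    and cont: "\<And>\<omega>. \<omega> \<in> predual M \<Longrightarrow> continuous_on (strip z) (\<lambda>w. \<omega> (f w))"
    and hol: "\<And>\<omega>. \<omega> \<in> predual M \<Longrightarrow> (\<lambda>w. \<omega> (f w)) holomorphic_on interior (strip z)"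
    and real: "\<And>t. f (complex_of_real t) = \<alpha> t x"
  shows "continuous_on (strip z) (\<lambda>w. f w v)"
proof (cases "z \<in> \<real>")
  case True
  have "continuous_on \<real> (\<lambda>w. \<alpha> (Re w) x v)"
    by (rule continuous_on_compose2[OF continuous_on_group_strong[OF x]]) (auto intro: continuous_intros)
  then have "continuous_on \<real> (\<lambda>w. f w v)"
    by (rule continuous_on_eq) (metis Reals_cases Re_complex_of_real real)
  then show ?thesis using True by (simp add: strip_def)
next
  case z: False
  have translate: "f (complex_of_real s + w) = \<alpha> s (f w)" if w: "w \<in> strip z" for s w
  proof (intro blinfun_eqI cinner_eqI)
    fix p q :: 'h
    define \<omega> where "\<omega> T = cinner (blinfun_apply T p) q" for T
    have \<omega>: "\<omega> \<in> predual M" unfolding \<omega>_def by (rule predual_vector_functional)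
    obtain \<Omega> c where \<Omega>: "finite \<Omega>" "\<Omega> \<subseteq> predual M"
      and sum: "\<And>y. y \<in> M \<Longrightarrow> \<omega> (\<alpha> s y) = (\<Sum>\<omega>\<in>\<Omega>. c \<omega> * \<omega> y)"
      using group unfolding weak_star_automorphism_group_def
      by (auto intro: predual_automorphism[OF vN _ _ \<omega>, of "\<alpha> s"])
    have img: "(\<lambda>w. complex_of_real s + 1 *\<^sub>R w) ` strip z \<subseteq> strip z"
      by (auto simp: strip_add_real)
    define h where "h w = \<omega> (f (complex_of_real s + 1 *\<^sub>R w)) - (\<Sum>\<omega>\<in>\<Omega>. c \<omega> * \<omega> (f w))" for w
    have "h w = 0"
    proof (rule zero_on_strip_if_zero_on_reals[OF z _ _ _ w])
      show "continuous_on (strip z) h"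
        unfolding h_def using \<Omega>
        by (intro continuous_intros continuous_on_affine[OF img cont[OF \<omega>]] cont) auto
      show "h holomorphic_on interior (strip z)"
        unfolding h_def using \<Omega>
        by (intro holomorphic_intros holomorphic_on_affine[OF _ img hol[OF \<omega>]] hol) auto
      show "h (complex_of_real t) = 0" for t
        using sum[OF fM[OF of_real_in_strip], of t] real[of t] real[of "s + t"] group_add[OF x, of s t]
        by (simp add: h_def)
    qed
    then show "cinner (f (complex_of_real s + w) p) q = cinner (\<alpha> s (f w) p) q"
      using sum[OF fM[OF w]] by (simp add: h_def \<omega>_def)
  qed
  show ?thesis
  proof (rule continuous_on_if_from_above_and_below, rule one_sided_tendsto_on_strip[OF z])
    show "continuous_on (strip z) (\<lambda>w. cinner (f w v) \<eta>)" for \<eta>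
      by (rule cont[OF predual_vector_functional])
    show "(\<lambda>w. cinner (f w v) \<eta>) holomorphic_on interior (strip z)" for \<eta>
      by (rule hol[OF predual_vector_functional])
    show "\<exists>K. \<forall>w\<in>C. norm (f w v) \<le> K" if C: "compact C" "C \<subseteq> strip z" for C
    proof -
      obtain K where "\<And>w. w \<in> C \<Longrightarrow> norm (f w) \<le> K"
        by (rule bounded_on_compact[OF C(1) continuous_on_subset[OF cont[OF predual_vector_functional] C(2)]])
          blast
      then have "norm (f w v) \<le> K * norm v" if "w \<in> C" for w
        using norm_blinfun[of "f w" v] that by (meson mult_right_mono norm_ge_zero order_trans)
      then show ?thesis by blast
    qed
    show "isCont (\<lambda>t. f (w\<^sub>0 + complex_of_real t) v) 0" if "w\<^sub>0 \<in> strip z" for w\<^sub>0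
      using continuous_on_group_strong[OF fM[OF that], of v] translate[OF that]
      by (simp add: add.commute continuous_on_eq_continuous_at)
  qed
qed

lemma strongly_continuous_adj_extension:
  fixes f :: "complex \<Rightarrow> 'h op"
  assumes x: "x \<in> M"
    and fM: "\<And>w. w \<in> strip z \<Longrightarrow> f w \<in> M"
    and cont: "\<And>\<omega>. \<omega> \<in> predual M \<Longrightarrow> continuous_on (strip z) (\<lambda>w. \<omega> (f w))"
    and hol: "\<And>\<omega>. \<omega> \<in> predual M \<Longrightarrow> (\<lambda>w. \<omega> (f w)) holomorphic_on interior (strip z)"
    and real: "\<And>t. f (complex_of_real t) = \<alpha> t x"
  shows "continuous_on (strip z) (\<lambda>w. adj (f w) v)"
proof -
  have cnj_strip: "cnj w \<in> strip z \<longleftrightarrow> w \<in> strip (cnj z)" for w z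
    by (simp add: strip_def complex_is_Real_iff)
  have cnj_image: "cnj ` strip (cnj z) = strip z"
    using cnj_strip by (auto intro!: image_eqI[where x = "cnj _"])
  have cnj_interior: "cnj ` interior (strip (cnj z)) = interior (strip z)"
    using interior_injective_linear_image[OF bounded_linear.linear[OF bounded_linear_cnj], of "strip (cnj z)"]
    by (simp add: cnj_image inj_on_def)
  have "continuous_on (strip (cnj z)) (\<lambda>w. adj (f (cnj w)) v)"
  proof (rule strongly_continuous_extension)
    show "adj x \<in> M" by (rule vna_adj[OF vN x])
    show "adj (f (cnj w)) \<in> M" if "w \<in> strip (cnj z)" for w
      using that by (intro vna_adj[OF vN] fM) (simp add: cnj_strip)
    show "adj (f (cnj (complex_of_real t))) = \<alpha> t (adj x)" for t
      by (simp add: real group_adj[OF x])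
    fix \<omega> assume "\<omega> \<in> predual M"
    then have \<omega>: "(\<lambda>y. cnj (\<omega> (adj y))) \<in> predual M" by (rule predual_cnj_adj[OF vN])
    have "continuous_on (strip (cnj z)) (\<lambda>w. cnj (cnj (\<omega> (adj (f (cnj w))))))"
      by (intro continuous_on_cnj continuous_on_compose2[OF cont[OF \<omega>]] continuous_intros)
         (simp add: cnj_image)
    then show "continuous_on (strip (cnj z)) (\<lambda>w. \<omega> (adj (f (cnj w))))" by simp
    have "cnj \<circ> (\<lambda>w. cnj (\<omega> (adj (f w)))) \<circ> cnj holomorphic_on interior (strip (cnj z))"
      by (rule holomorphic_on_compose_cnj_cnj) (simp_all add: cnj_interior hol[OF \<omega>])
    then show "(\<lambda>w. \<omega> (adj (f (cnj w)))) holomorphic_on interior (strip (cnj z))"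
      by (simp add: o_def)
  qed
  then have "continuous_on (strip z) (\<lambda>w. adj (f (cnj (cnj w))) v)"
    by (rule continuous_on_compose2) (auto intro!: continuous_intros simp: cnj_strip[symmetric])
  then show ?thesis by simp
qed

end

end

theorem theorem2p16:
  fixes M :: "'h::complex_hilbert op set"
    and \<alpha> :: "real \<Rightarrow> 'h op \<Rightarrow> 'h op"
    and x :: "'h op"
    and z :: complex
    and f :: "complex \<Rightarrow> 'h op"
  assumes "von_neumann_algebra M"
    and "weak_star_automorphism_group M \<alpha>"
    and "x \<in> M"
    and "weak_star_regular M z f"
    and "\<forall>t::real. f (complex_of_real t) = \<alpha> t x"
  shows "continuous_map (top_of_set (strip z)) (sigma_strong_star_topology M) f \<and>
         continuous_map (top_of_set (strip z)) (sigma_strong_topology M) f"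
proof -
  note vN = assms(1)
  have f: "continuous_map (top_of_set (strip z)) (weak_star_topology M) f"
    and hol: "\<And>\<omega>. \<omega> \<in> predual M \<Longrightarrow> (\<lambda>w. \<omega> (f w)) holomorphic_on interior (strip z)"
    using assms(4) by (auto simp: weak_star_regular_def)
  have fM: "f w \<in> M" if "w \<in> strip z" for w
    using continuous_map_image_subset_topspace[OF f] that by (auto simp: topspace_weak_star)
  note ext = assms(3) fM continuous_on_predual[OF vN f] hol assms(5)[rule_format]
  have dM: "f w - y \<in> M" if "w \<in> strip z" "y \<in> M" for w y
    using that by (intro vna_diff[OF vN] fM)
  have strong: "continuous_on (strip z) (\<lambda>w. \<omega> (adj (f w - y) o\<^sub>L (f w - y)))"
    if "\<omega> \<in> predual M" "y \<in> M" for \<omega> y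
  proof (rule continuous_on_predual_adj_comp[OF vN closed_strip _ _ that(1)])
    show "f w - y \<in> M" if "w \<in> strip z" for w by (rule dM[OF that \<open>y \<in> M\<close>])
    show "continuous_on (strip z) (\<lambda>w. (f w - y) v)" for v
      unfolding blinfun.diff_left
      by (intro continuous_intros strongly_continuous_extension[OF vN assms(2) ext])
  qed
  have strong_adj: "continuous_on (strip z) (\<lambda>w. \<omega> ((f w - y) o\<^sub>L adj (f w - y)))"
    if "\<omega> \<in> predual M" "y \<in> M" for \<omega> y
  proof -
    have "continuous_on (strip z) (\<lambda>w. \<omega> (adj (adj (f w - y)) o\<^sub>L adj (f w - y)))"
    proof (rule continuous_on_predual_adj_comp[OF vN closed_strip _ _ that(1)])
      show "adj (f w - y) \<in> M" if "w \<in> strip z" for w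
        by (intro vna_adj[OF vN] dM that \<open>y \<in> M\<close>)
      have "continuous_on (strip z) (\<lambda>w. adj (f w) v - adj y v)" for v
        by (intro continuous_intros strongly_continuous_adj_extension[OF vN assms(2) ext])
      then show "continuous_on (strip z) (\<lambda>w. adj (f w - y) v)" for v
        by (rule continuous_on_eq) (simp add: vna_adj_diff[OF vN fM \<open>y \<in> M\<close>] blinfun.diff_left)
    qed
    then show ?thesis
      by (rule continuous_on_eq) (simp add: vna_adj_adj[OF vN dM[OF _ \<open>y \<in> M\<close>]])
  qed
  have "continuous_map (top_of_set (strip z)) (sigma_strong_star_topology M) f"
    unfolding sigma_strong_star_topology_def
  proof (rule continuous_map_seminorm_topology[OF topspace_sigma_strong_star[unfolded sigma_strong_star_topology_def]])
    fix p y
    assume "p \<in> {\<lambda>x. sqrt (Re (\<omega> ((adj x o\<^sub>L x) + (x o\<^sub>L adj x)))) |\<omega>. \<omega> \<in> predual_pos M}" and y: "y \<in> M"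
    then obtain \<omega> where p: "p = (\<lambda>x. sqrt (Re (\<omega> ((adj x o\<^sub>L x) + (x o\<^sub>L adj x)))))" and \<omega>: "\<omega> \<in> predual M"
      by (auto simp: predual_pos_def)
    have "continuous_on (strip z) (\<lambda>w. sqrt (Re (\<omega> (adj (f w - y) o\<^sub>L (f w - y)) + \<omega> ((f w - y) o\<^sub>L adj (f w - y)))))"
      by (intro continuous_intros strong strong_adj \<omega> y)
    then show "continuous_on (strip z) (\<lambda>w. p (f w - y))"
    proof (rule continuous_on_eq)
      fix w assume "w \<in> strip z"
      note d = dM[OF this y]
      show "sqrt (Re (\<omega> (adj (f w - y) o\<^sub>L (f w - y)) + \<omega> ((f w - y) o\<^sub>L adj (f w - y)))) = p (f w - y)"
        unfolding p using predual_add[OF vN \<omega> vna_comp[OF vN vna_adj[OF vN d] d] vna_comp[OF vN d vna_adj[OF vN d]]]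
        by simp
    qed
  qed (use fM in auto)
  moreover have "continuous_map (top_of_set (strip z)) (sigma_strong_topology M) f"
    unfolding sigma_strong_topology_def
  proof (rule continuous_map_seminorm_topology[OF topspace_sigma_strong[unfolded sigma_strong_topology_def]])
    fix p y
    assume "p \<in> {\<lambda>x. sqrt (Re (\<omega> (adj x o\<^sub>L x))) |\<omega>. \<omega> \<in> predual_pos M}" and y: "y \<in> M"
    then obtain \<omega> where "p = (\<lambda>x. sqrt (Re (\<omega> (adj x o\<^sub>L x))))" "\<omega> \<in> predual M"
      by (auto simp: predual_pos_def)
    then show "continuous_on (strip z) (\<lambda>w. p (f w - y))"
      using strong[OF _ y] by (auto intro!: continuous_intros)
  qed (use fM in auto)
  ultimately show ?thesis by blast
qed

end
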